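(* If an epigroup variety is a lower-modular element of the lattice $\mathbf{EPI}$ then it is a modular element of this lattice.
   Context: An epigroup is a semigroup $S$ such that for every $x\in S$ some power $x^n$ ($n\ge 1$) lies in a subgroup of $S$. For $x\in S$ some power of $x$ lies in a maximal subgroup $G_x$ of $S$; its unit is denoted $x^\omega$. Then $xx^\omega=x^\omega x\in G_x$, and the pseudoinverse $\overline{x}$ of $x$ is the inverse of $xx^\omega$ in $G_x$. Epigroups are considered as algebras with multiplication and the unary operation $x\mapsto\overline{x}$; an epigroup variety is a variety of such algebras consisting of epigroups. $\mathbf{EPI}$ is the lattice of all epigroup varieties under inclusion: $\wedge$ is intersection, and $\mathcal X\vee\mathcal Y$ is the least epigroup variety containing $\mathcal X$ and $\mathcal Y$. An element $x$ of a lattice $\langle L;\vee,\wedge\rangle$ is: modular if $(x\vee y)\wedge z=(x\wedge z)\vee y$ for all $y,z\in L$ with $y\le z$; lower-modular if $(z\wedge y)\vee x=(z\vee x)\wedge y$ for all $y,z\in L$ with $x\le y$. *)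

theory Defs
  imports "HOL-Algebra.Lattice" "HOL-Algebra.Group" "HOL-Library.Infinite_Typeclass"
begin

section \<open>Algebras with one binary and one unary operation\<close>

record 'a alg21 = "'a partial_object" +
  mul :: "'a \<Rightarrow> 'a \<Rightarrow> 'a"
  uop :: "'a \<Rightarrow> 'a"

definition algebra21 :: "'a alg21 \<Rightarrow> bool" where
  "algebra21 S \<longleftrightarrow> carrier S \<noteq> {} \<and>
     (\<forall>x\<in>carrier S. \<forall>y\<in>carrier S. mul S x y \<in> carrier S) \<and>
     (\<forall>x\<in>carrier S. uop S x \<in> carrier S)"

datatype uterm = Var nat | Mul uterm uterm | Uop uterm

primrec eval_term :: "'a alg21 \<Rightarrow> (nat \<Rightarrow> 'a) \<Rightarrow> uterm \<Rightarrow> 'a" where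
  "eval_term S v (Var i) = v i"
| "eval_term S v (Mul s t) = mul S (eval_term S v s) (eval_term S v t)"
| "eval_term S v (Uop t) = uop S (eval_term S v t)"

definition satisfies :: "'a alg21 \<Rightarrow> uterm \<times> uterm \<Rightarrow> bool" where
  "satisfies S p \<longleftrightarrow>
     (\<forall>v. (\<forall>i. v i \<in> carrier S) \<longrightarrow> eval_term S v (fst p) = eval_term S v (snd p))"

definition Models :: "(uterm \<times> uterm) set \<Rightarrow> 'a alg21 set" where
  "Models \<Sigma> = {S. algebra21 S \<and> (\<forall>p\<in>\<Sigma>. satisfies S p)}"

text \<open>
  Varieties are equational classes, restricted to the algebras carried by subsets of the
  type \<open>'a\<close>. For infinite \<open>'a\<close> nothing is lost: a variety is determined by its countably
  generated free algebra, which is countable and hence has a copy inside \<open>'a\<close>; and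
  being an epigroup whose unary operation is the pseudoinverse is a property of the
  one-generated (hence countable) subalgebras. Hence the lattice defined below does not depend,
  up to isomorphism, on the choice of the infinite type \<open>'a\<close>.
\<close>

definition variety :: "'a alg21 set \<Rightarrow> bool" where
  "variety V \<longleftrightarrow> (\<exists>\<Sigma>. V = Models \<Sigma>)"

section \<open>Epigroups\<close>

definition semigroup_alg :: "'a alg21 \<Rightarrow> bool" where
  "semigroup_alg S \<longleftrightarrow> algebra21 S \<and>
     (\<forall>x\<in>carrier S. \<forall>y\<in>carrier S. \<forall>z\<in>carrier S. mul S (mul S x y) z = mul S x (mul S y z))"

text \<open>Semigroups have no zeroth powers: \<open>power_Suc S x n\<close> is $x^{n+1}$.\<close>

primrec power_Suc :: "'a alg21 \<Rightarrow> 'a \<Rightarrow> nat \<Rightarrow> 'a" where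
  "power_Suc S x 0 = x"
| "power_Suc S x (Suc n) = mul S (power_Suc S x n) x"

abbreviation group_on :: "'a alg21 \<Rightarrow> 'a set \<Rightarrow> 'a \<Rightarrow> 'a monoid" where
  "group_on S G e \<equiv> \<lparr>carrier = G, monoid.mult = mul S, one = e\<rparr>"

text \<open>A subgroup of a semigroup has its own unit \<open>e\<close>, an arbitrary idempotent of the semigroup.\<close>

definition sg_subgroup :: "'a alg21 \<Rightarrow> 'a set \<Rightarrow> 'a \<Rightarrow> bool" where
  "sg_subgroup S G e \<longleftrightarrow> G \<subseteq> carrier S \<and> group (group_on S G e)"

definition maximal_sg_subgroup :: "'a alg21 \<Rightarrow> 'a set \<Rightarrow> 'a \<Rightarrow> bool" where
  "maximal_sg_subgroup S G e \<longleftrightarrow> sg_subgroup S G e \<and>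
     (\<forall>H f. sg_subgroup S H f \<and> G \<subseteq> H \<longrightarrow> H = G)"

definition epigroup :: "'a alg21 \<Rightarrow> bool" where
  "epigroup S \<longleftrightarrow> semigroup_alg S \<and>
     (\<forall>x\<in>carrier S. \<exists>n G e. sg_subgroup S G e \<and> power_Suc S x n \<in> G)"

text \<open>Here \<open>G\<close> is the group $G_x$ and \<open>e\<close> is $x^\omega$.\<close>

definition is_pseudoinverse :: "'a alg21 \<Rightarrow> 'a \<Rightarrow> 'a \<Rightarrow> bool" where
  "is_pseudoinverse S x y \<longleftrightarrow>
     (\<exists>n G e. maximal_sg_subgroup S G e \<and> power_Suc S x n \<in> G \<and>
        mul S x e \<in> G \<and> y = inv\<^bsub>group_on S G e\<^esub> (mul S x e))"

definition epigroup_alg :: "'a alg21 \<Rightarrow> bool" where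
  "epigroup_alg S \<longleftrightarrow> epigroup S \<and> (\<forall>x\<in>carrier S. is_pseudoinverse S x (uop S x))"

definition epigroup_variety :: "'a alg21 set \<Rightarrow> bool" where
  "epigroup_variety V \<longleftrightarrow> variety V \<and> (\<forall>S\<in>V. epigroup_alg S)"

section \<open>The lattice of epigroup varieties and its special elements\<close>

definition EPI :: "'a::infinite alg21 set gorder" where
  "EPI = \<lparr>carrier = {V. epigroup_variety V}, eq = (=), le = (\<subseteq>)\<rparr>"

definition modular_element :: "('b, 'c) gorder_scheme \<Rightarrow> 'b \<Rightarrow> bool" where
  "modular_element L x \<longleftrightarrow> x \<in> carrier L \<and>
     (\<forall>y\<in>carrier L. \<forall>z\<in>carrier L. y \<sqsubseteq>\<^bsub>L\<^esub> z \<longrightarrow>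
        (x \<squnion>\<^bsub>L\<^esub> y) \<sqinter>\<^bsub>L\<^esub> z = (x \<sqinter>\<^bsub>L\<^esub> z) \<squnion>\<^bsub>L\<^esub> y)"

definition lower_modular_element :: "('b, 'c) gorder_scheme \<Rightarrow> 'b \<Rightarrow> bool" where
  "lower_modular_element L x \<longleftrightarrow> x \<in> carrier L \<and>
     (\<forall>y\<in>carrier L. \<forall>z\<in>carrier L. x \<sqsubseteq>\<^bsub>L\<^esub> y \<longrightarrow>
        (z \<sqinter>\<^bsub>L\<^esub> y) \<squnion>\<^bsub>L\<^esub> x = (z \<squnion>\<^bsub>L\<^esub> x) \<sqinter>\<^bsub>L\<^esub> y)"

text \<open>
  The order-theoretic meet and join of the library are the intersection and the least
  epigroup variety containing both arguments.
\<close>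

lemma partial_order_EPI: "partial_order EPI"
  by unfold_locales (auto simp: EPI_def)

lemma epigroup_variety_Int:
  assumes "epigroup_variety X" "epigroup_variety Y"
  shows "epigroup_variety (X \<inter> Y)"
proof -
  obtain \<Sigma> \<Delta> where "X = Models \<Sigma>" "Y = Models \<Delta>"
    using assms unfolding epigroup_variety_def variety_def by blast
  then have "X \<inter> Y = Models (\<Sigma> \<union> \<Delta>)"
    by (auto simp: Models_def)
  then show ?thesis
    using assms unfolding epigroup_variety_def variety_def by blast
qed

lemma meet_EPI:
  assumes "epigroup_variety X" "epigroup_variety Y"
  shows "X \<sqinter>\<^bsub>EPI\<^esub> Y = X \<inter> Y"
proof -
  interpret partial_order EPI by (rule partial_order_EPI)
  have g: "greatest EPI (X \<inter> Y) (Lower EPI {X, Y})"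
    using assms epigroup_variety_Int[OF assms]
    by (auto simp: greatest_def Lower_def EPI_def)
  show ?thesis
    unfolding meet_def inf_def
    by (rule some_equality, rule g) (use g greatest_unique in blast)
qed

lemma join_EPI:
  assumes "epigroup_variety X" "epigroup_variety Y"
    and "epigroup_variety J" "X \<subseteq> J" "Y \<subseteq> J"
    and "\<And>Z. epigroup_variety Z \<Longrightarrow> X \<subseteq> Z \<Longrightarrow> Y \<subseteq> Z \<Longrightarrow> J \<subseteq> Z"
  shows "X \<squnion>\<^bsub>EPI\<^esub> Y = J"
proof -
  interpret partial_order EPI by (rule partial_order_EPI)
  have l: "least EPI J (Upper EPI {X, Y})"
    using assms by (auto simp: least_def Upper_def EPI_def)
  show ?thesis
    unfolding join_def sup_def
    by (rule some_equality, rule l) (use l least_unique in blast)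
qed

end

theory Submission
  imports Defs Complex_Main "HOL-Library.Countable"
begin

text \<open>An epigroup variety is determined by its equational theory, a fully invariant congruence on the
term algebra, and such a congruence \<open>\<theta>\<close> belongs to an epigroup variety iff it contains the
identities \<open>epi_axioms k\<close> for some \<open>k\<close>. Under this correspondence the intersection of varieties
becomes the join \<open>(\<theta> \<union> \<eta>)\<^sup>*\<close> of congruences and the join of varieties becomes the intersection of
congruences. Let \<open>\<nu>\<close> be the theory of \<open>X\<close>. If \<open>X\<close> is lower-modular, \<open>\<eta> \<subseteq> \<nu>\<close>, and a chain of steps in
\<open>\<zeta>\<close>, \<open>\<eta>\<close>, \<open>\<zeta>\<close> connects two \<open>\<nu>\<close>-related terms of which the first is isolated with respect to \<open>\<eta>\<close>,
then the first term is already moved by \<open>\<zeta> \<inter> \<nu>\<close> (\<open>lower_modular_escape\<close>). Two choices of \<open>\<zeta>\<close> and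
\<open>\<eta>\<close> determine the shape of \<open>\<nu>\<close>.

First, let two words \<open>a\<close> and \<open>b\<close> of equal length and content, where \<open>a\<close> does not arise from \<open>b\<close> by
renaming letters, both be \<open>\<nu>\<close>-related to terms that contain the unary operation. Take for \<open>\<zeta>\<close> the
theory of a free nilpotent semigroup, with zero-identities added so that \<open>a\<close> and \<open>b\<close> can be identified
without further consequences for \<open>a\<close>, so that the only possible step from \<open>a\<close> leads to \<open>b\<close>; hence \<open>a\<close>
and \<open>b\<close> are \<open>\<nu>\<close>-related (\<open>words_related\<close>). Words that contain a high power satisfy the
hypothesis. Four instances of the conclusion show that in every member of \<open>X\<close> the pseudoinverse
of \<open>x\<close> is a power \<open>x\<^sup>n\<close>, and that \<open>x \<mapsto> x\<^sup>n\<close> is an idempotent endomorphism with central values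
and \<open>x\<^sup>n y = x\<^sup>n y\<^sup>n\<close>; so any two terms containing the unary operation and having the same variables are
\<open>\<nu>\<close>-related (\<open>nonwords_related\<close>).

Second, let \<open>(s, s') \<in> \<nu>\<close> be an identity whose left side is a word different from the right side.
Take for \<open>\<zeta>\<close> the identities of the group of affine maps of the rational line. There \<open>s\<close> equals
\<open>s s\<^sup>-\<^sup>1 s\<close>, the corresponding term for \<open>s'\<close> is \<open>\<nu>\<close>-related to it by the first part, and distinct words
take distinct values. So \<open>\<zeta>\<close> can move \<open>s\<close> only to a term containing the unary operation, and \<open>s\<close>
is \<open>\<nu>\<close>-related to such a term (\<open>collapse\<close>).

Consequently \<open>\<nu>\<close> identifies two terms only if they spell the same word or both lie in a fully
invariant set of zeros, and on the zeros it is either the full relation or equality of variables: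
\<open>X\<close> is a variety given by zero-identities, possibly joined with the semilattices. Such a theory is
modular (\<open>modular_inclusion\<close>): in a chain of \<open>\<nu>\<close>- and \<open>\<zeta>\<close>-steps everything between the first and the
last zero can be replaced by a single \<open>\<nu>\<close>-step, after the sets of variables of the two zeros have
been made equal by means of \<open>\<zeta>\<close>.\<close>

section \<open>Equational theories and the completeness theorem\<close>

primrec subst :: "(nat \<Rightarrow> uterm) \<Rightarrow> uterm \<Rightarrow> uterm" where
  "subst \<sigma> (Var i) = \<sigma> i"
| "subst \<sigma> (Mul s t) = Mul (subst \<sigma> s) (subst \<sigma> t)"
| "subst \<sigma> (Uop t) = Uop (subst \<sigma> t)"

locale eq_theory =
  fixes \<theta> :: "(uterm \<times> uterm) set"
  assumes refl: "(s, s) \<in> \<theta>"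
    and sym: "(s, t) \<in> \<theta> \<Longrightarrow> (t, s) \<in> \<theta>"
    and trans: "(s, t) \<in> \<theta> \<Longrightarrow> (t, r) \<in> \<theta> \<Longrightarrow> (s, r) \<in> \<theta>"
    and mul: "(s, s') \<in> \<theta> \<Longrightarrow> (t, t') \<in> \<theta> \<Longrightarrow> (Mul s t, Mul s' t') \<in> \<theta>"
    and uop: "(s, s') \<in> \<theta> \<Longrightarrow> (Uop s, Uop s') \<in> \<theta>"
    and subst: "(s, t) \<in> \<theta> \<Longrightarrow> (subst \<sigma> s, subst \<sigma> t) \<in> \<theta>"

definition Eq :: "'a alg21 set \<Rightarrow> (uterm \<times> uterm) set" where
  "Eq K = {p. \<forall>S\<in>K. satisfies S p}"

lemma eval_subst: "eval_term S v (subst \<sigma> t) = eval_term S (\<lambda>i. eval_term S v (\<sigma> i)) t"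
  by (induction t) auto

lemma eval_closed:
  assumes "algebra21 S" "\<And>i. v i \<in> carrier S"
  shows "eval_term S v t \<in> carrier S"
  using assms by (induction t) (auto simp: algebra21_def)

lemma eq_theory_Eq:
  assumes "\<And>S. S \<in> K \<Longrightarrow> algebra21 S"
  shows "eq_theory (Eq K)"
proof
  fix s t \<sigma> assume "(s, t) \<in> Eq K"
  then show "(subst \<sigma> s, subst \<sigma> t) \<in> Eq K"
    using assms by (auto simp: Eq_def satisfies_def eval_subst eval_closed)
qed (auto simp: Eq_def satisfies_def)

lemma Models_Eq: "variety V \<Longrightarrow> Models (Eq V) = V"
  unfolding variety_def Models_def Eq_def by blast

lemma eq_theory_Eq_variety: "variety V \<Longrightarrow> eq_theory (Eq V)"
  by (rule eq_theory_Eq) (auto simp: variety_def Models_def)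

lemma (in eq_theory) subst_cong:
  assumes "\<And>i. (\<sigma> i, \<tau> i) \<in> \<theta>"
  shows "(subst \<sigma> t, subst \<tau> t) \<in> \<theta>"
  by (induction t) (auto intro: assms mul uop)

instance uterm :: countable
  by countable_datatype

text \<open>\<open>F\<close> is a copy of the term algebra modulo \<open>\<theta>\<close>, with \<open>q\<close> as the canonical projection.\<close>

definition term_quotient :: "(uterm \<times> uterm) set \<Rightarrow> 'a alg21 \<Rightarrow> (uterm \<Rightarrow> 'a) \<Rightarrow> bool" where
  "term_quotient \<theta> F q \<longleftrightarrow> F \<in> Models \<theta> \<and> (\<forall>s t. q s = q t \<longleftrightarrow> (s, t) \<in> \<theta>) \<and>
     (\<forall>t. q t \<in> carrier F) \<and> (\<forall>s t. mul F (q s) (q t) = q (Mul s t)) \<and>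
     (\<forall>t. uop F (q t) = q (Uop t))"

text \<open>The term algebra modulo \<open>\<theta>\<close> is countable, so it has a copy inside every infinite type.\<close>

lemma (in eq_theory) ex_term_quotient: "\<exists>(F :: 'a::infinite alg21) q. term_quotient \<theta> F q"
proof -
  obtain h :: "nat \<Rightarrow> 'a" where h: "inj h"
    using infinite_UNIV infinite_countable_subset by blast
  define rep where "rep t = (SOME s. (t, s) \<in> \<theta>)" for t
  have rep: "(t, rep t) \<in> \<theta>" for t
    unfolding rep_def by (rule someI, rule refl)
  have rep_eq: "rep s = rep t \<longleftrightarrow> (s, t) \<in> \<theta>" for s t
  proof
    show "rep s = rep t \<Longrightarrow> (s, t) \<in> \<theta>"
      by (metis rep sym trans)
    assume st: "(s, t) \<in> \<theta>"
    have "(s, r) \<in> \<theta> \<longleftrightarrow> (t, r) \<in> \<theta>" for r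
      using st sym trans by blast
    then show "rep s = rep t"
      unfolding rep_def by simp
  qed
  define q where "q t = h (to_nat (rep t))" for t
  have q: "q s = q t \<longleftrightarrow> (s, t) \<in> \<theta>" for s t
    unfolding q_def using rep_eq inj_eq[OF h] by simp
  define g where "g a = (SOME t. q t = a)" for a
  have "q (g (q t)) = q t" for t
    unfolding g_def by (rule someI) (rule HOL.refl)
  then have g: "(g (q t), t) \<in> \<theta>" for t
    using q by blast
  define F where "F = \<lparr>carrier = range q, mul = \<lambda>a b. q (Mul (g a) (g b)), uop = \<lambda>a. q (Uop (g a))\<rparr>"
  have m: "mul F (q s) (q t) = q (Mul s t)" for s t
    by (simp add: F_def q mul g)
  have u: "uop F (q t) = q (Uop t)" for t
    by (simp add: F_def q uop g)
  have c: "carrier F = range q"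
    by (simp add: F_def)
  have alg: "algebra21 F"
    unfolding algebra21_def using c m u by auto
  have "satisfies F p" if "p \<in> \<theta>" for p
    unfolding satisfies_def
  proof (intro allI impI)
    fix v :: "nat \<Rightarrow> 'a" assume "\<forall>i. v i \<in> carrier F"
    then have "\<forall>i. \<exists>t. v i = q t"
      unfolding c by blast
    then obtain \<sigma> where v: "\<And>i. v i = q (\<sigma> i)"
      by (auto dest: choice)
    have "eval_term F v t = q (subst \<sigma> t)" for t
      by (induction t) (auto simp: v m u)
    then show "eval_term F v (fst p) = eval_term F v (snd p)"
      using that subst[of "fst p" "snd p" \<sigma>] q by simp
  qed
  with alg have "F \<in> Models \<theta>"
    by (simp add: Models_def)
  then show ?thesis
    unfolding term_quotient_def by (intro exI[of _ F] exI[of _ q]) (auto simp: q c m u)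
qed

text \<open>Birkhoff's completeness theorem: by evaluation at the generators, the copy of the term algebra
  modulo \<open>\<theta>\<close> refutes every identity outside \<open>\<theta>\<close>.\<close>

lemma (in eq_theory) Eq_Models: "Eq (Models \<theta> :: 'a::infinite alg21 set) = \<theta>"
proof
  show "Eq (Models \<theta> :: 'a alg21 set) \<subseteq> \<theta>"
  proof
    fix p assume p: "p \<in> Eq (Models \<theta> :: 'a alg21 set)"
    obtain F :: "'a alg21" and q where Fq: "term_quotient \<theta> F q"
      using ex_term_quotient by blast
    note F = Fq[unfolded term_quotient_def]
    have ev: "eval_term F (\<lambda>i. q (Var i)) t = q t" for t
      by (induction t) (auto simp: F)
    have "satisfies F p"
      using p F by (auto simp: Eq_def)
    then have "eval_term F (\<lambda>i. q (Var i)) (fst p) = eval_term F (\<lambda>i. q (Var i)) (snd p)"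
      unfolding satisfies_def using F by simp
    then have "q (fst p) = q (snd p)"
      by (simp only: ev)
    then show "p \<in> \<theta>"
      using F by simp
  qed
qed (auto simp: Eq_def Models_def)

lemma eq_theory_Int:
  assumes "eq_theory \<theta>" "eq_theory \<eta>"
  shows "eq_theory (\<theta> \<inter> \<eta>)"
proof -
  interpret A: eq_theory \<theta> by fact
  interpret B: eq_theory \<eta> by fact
  show ?thesis
  proof
    fix s t r assume "(s, t) \<in> \<theta> \<inter> \<eta>" "(t, r) \<in> \<theta> \<inter> \<eta>"
    then show "(s, r) \<in> \<theta> \<inter> \<eta>"
      using A.trans B.trans by blast
  next
    fix s t assume "(s, t) \<in> \<theta> \<inter> \<eta>"
    then show "(t, s) \<in> \<theta> \<inter> \<eta>"
      using A.sym B.sym by simp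
  qed (simp_all add: A.refl B.refl A.mul B.mul A.uop B.uop A.subst B.subst)
qed

lemma eq_theory_join:
  assumes "eq_theory \<theta>" "eq_theory \<eta>"
  shows "eq_theory ((\<theta> \<union> \<eta>)\<^sup>*)"
proof
  interpret A: eq_theory \<theta> by fact
  interpret B: eq_theory \<eta> by fact
  let ?R = "(\<theta> \<union> \<eta>)\<^sup>*"
  have "sym (\<theta> \<union> \<eta>)"
    unfolding sym_def using A.sym B.sym by blast
  then have "sym ?R"
    by (rule sym_rtrancl)
  then show "(s, t) \<in> ?R \<Longrightarrow> (t, s) \<in> ?R" for s t
    by (rule symD)
  show "(s, t) \<in> ?R \<Longrightarrow> (t, r) \<in> ?R \<Longrightarrow> (s, r) \<in> ?R" for s t r
    by (rule rtrancl_trans)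
  have lift: "(f s, f t) \<in> ?R" if "(s, t) \<in> ?R" "\<And>s t. (s, t) \<in> \<theta> \<union> \<eta> \<Longrightarrow> (f s, f t) \<in> \<theta> \<union> \<eta>" for f s t
    using that(1)
  proof induction
    case (step t r)
    from step.IH that(2)[OF step.hyps(2)] show ?case by (rule rtrancl_into_rtrancl)
  qed simp
  show "(Mul s t, Mul s' t') \<in> ?R" if "(s, s') \<in> ?R" "(t, t') \<in> ?R" for s s' t t'
  proof -
    have "(Mul s t, Mul s' t) \<in> ?R"
      by (rule lift[OF that(1), where f = "\<lambda>x. Mul x t"]) (use A.mul A.refl B.mul B.refl in blast)
    moreover have "(Mul s' t, Mul s' t') \<in> ?R"
      by (rule lift[OF that(2), where f = "Mul s'"]) (use A.mul A.refl B.mul B.refl in blast)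
    ultimately show ?thesis by (rule rtrancl_trans)
  qed
  show "(Uop s, Uop s') \<in> ?R" if "(s, s') \<in> ?R" for s s'
    by (rule lift[OF that, where f = Uop]) (use A.uop B.uop in blast)
  show "(subst \<sigma> s, subst \<sigma> s') \<in> ?R" if "(s, s') \<in> ?R" for s s' \<sigma>
    by (rule lift[OF that, where f = "subst \<sigma>"]) (use A.subst B.subst in blast)
qed simp

lemma Models_Int: "Models \<theta> \<inter> Models \<eta> = Models (\<theta> \<union> \<eta>)"
  by (auto simp: Models_def)

lemma Models_antimono: "\<theta> \<subseteq> \<eta> \<Longrightarrow> Models \<eta> \<subseteq> Models \<theta>"
  by (auto simp: Models_def)

lemma Eq_antimono: "V \<subseteq> W \<Longrightarrow> Eq W \<subseteq> Eq V"
  by (auto simp: Eq_def)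

lemma Models_join:
  assumes "eq_theory \<theta>" "eq_theory \<eta>"
  shows "Models ((\<theta> \<union> \<eta>)\<^sup>*) = Models (\<theta> \<union> \<eta>)"
proof
  show "Models (\<theta> \<union> \<eta>) \<subseteq> Models ((\<theta> \<union> \<eta>)\<^sup>*)"
  proof
    fix S assume S: "S \<in> Models (\<theta> \<union> \<eta>)"
    then have S1: "eq_theory (Eq {S})"
      by (intro eq_theory_Eq) (auto simp: Models_def)
    have "(s, t) \<in> Eq {S}" if "(s, t) \<in> (\<theta> \<union> \<eta>)\<^sup>*" for s t
      using that
    proof induction
      case base
      then show ?case using S1 by (rule eq_theory.refl)
    next
      case (step t r)
      have "(t, r) \<in> Eq {S}"
        using step S by (auto simp: Models_def Eq_def)
      then show ?case using S1 step eq_theory.trans by blast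
    qed
    then show "S \<in> Models ((\<theta> \<union> \<eta>)\<^sup>*)"
      using S by (auto simp: Models_def Eq_def)
  qed
qed (rule Models_antimono, blast)

lemma Eq_Models_join:
  assumes "eq_theory \<theta>" "eq_theory \<eta>"
  shows "Eq (Models \<theta> \<inter> Models \<eta> :: 'a::infinite alg21 set) = (\<theta> \<union> \<eta>)\<^sup>*"
  unfolding Models_Int Models_join[OF assms, symmetric]
  by (rule eq_theory.Eq_Models[OF eq_theory_join[OF assms]])

section \<open>Epigroup varieties as equational theories\<close>

text \<open>As for \<open>power_Suc\<close>, the exponent is \<open>n + 1\<close>.\<close>

primrec power_term :: "uterm \<Rightarrow> nat \<Rightarrow> uterm" where
  "power_term t 0 = t"
| "power_term t (Suc n) = Mul (power_term t n) t"

lemma eval_power_term: "eval_term S v (power_term t n) = power_Suc S (eval_term S v t) n"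
  by (induction n) auto

lemma subst_power_term: "subst \<sigma> (power_term t n) = power_term (subst \<sigma> t) n"
  by (induction n) auto

text \<open>The identities of the epigroups in which the power with exponent \<open>k + 1\<close> of every element lies in a
subgroup: \<open>uop S x\<close> commutes with \<open>x\<close>, and \<open>mul S x (uop S x)\<close> is the unit of that subgroup.\<close>

definition epi_axioms :: "nat \<Rightarrow> (uterm \<times> uterm) set" where
  "epi_axioms k =
     {(Mul (Mul (Var 0) (Var 1)) (Var 2), Mul (Var 0) (Mul (Var 1) (Var 2))),
      (Mul (Var 0) (Uop (Var 0)), Mul (Uop (Var 0)) (Var 0)),
      (Mul (Mul (Var 0) (Uop (Var 0))) (Uop (Var 0)), Uop (Var 0)),
      (Mul (power_term (Var 0) k) (Mul (Var 0) (Uop (Var 0))), power_term (Var 0) k)}"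

locale semigroup_algebra =
  fixes S :: "'a alg21"
  assumes alg: "algebra21 S"
    and assoc: "\<And>x y z. x \<in> carrier S \<Longrightarrow> y \<in> carrier S \<Longrightarrow> z \<in> carrier S \<Longrightarrow>
      mul S (mul S x y) z = mul S x (mul S y z)"
begin

lemma mul_closed [simp]: "x \<in> carrier S \<Longrightarrow> y \<in> carrier S \<Longrightarrow> mul S x y \<in> carrier S"
  and uop_closed [simp]: "x \<in> carrier S \<Longrightarrow> uop S x \<in> carrier S"
  using alg by (auto simp: algebra21_def)

lemma power_closed [simp]: "x \<in> carrier S \<Longrightarrow> power_Suc S x n \<in> carrier S"
  by (induction n) auto

lemma power_add:
  "x \<in> carrier S \<Longrightarrow> mul S (power_Suc S x m) (power_Suc S x n) = power_Suc S x (Suc (m + n))"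
  by (induction n) (auto simp flip: assoc)

lemma power_commute: "x \<in> carrier S \<Longrightarrow> mul S x (power_Suc S x n) = mul S (power_Suc S x n) x"
  using power_add[of x 0 n] power_add[of x n 0] by simp

text \<open>The largest subgroup with unit \<open>e\<close>.\<close>

definition units_at :: "'a \<Rightarrow> 'a set" where
  "units_at e = {a \<in> carrier S. mul S e a = a \<and> mul S a e = a \<and>
     (\<exists>b\<in>carrier S. mul S e b = b \<and> mul S b e = b \<and> mul S a b = e \<and> mul S b a = e)}"

lemma units_atI:
  assumes "a \<in> carrier S" "b \<in> carrier S" "mul S e a = a" "mul S a e = a"
    "mul S e b = b" "mul S b e = b" "mul S a b = e" "mul S b a = e"
  shows "a \<in> units_at e"
  using assms unfolding units_at_def by blast

lemma mul_units_at:
  assumes "a \<in> units_at e" "c \<in> units_at e" "e \<in> carrier S"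
  shows "mul S a c \<in> units_at e"
proof -
  from assms(1) obtain b where a: "a \<in> carrier S" "mul S e a = a" "mul S a e = a"
    and b: "b \<in> carrier S" "mul S e b = b" "mul S b e = b" "mul S a b = e" "mul S b a = e"
    unfolding units_at_def by blast
  from assms(2) obtain d where c: "c \<in> carrier S" "mul S e c = c" "mul S c e = c"
    and d: "d \<in> carrier S" "mul S e d = d" "mul S d e = d" "mul S c d = e" "mul S d c = e"
    unfolding units_at_def by blast
  have "mul S c (mul S d b) = b" "mul S b (mul S a c) = c"
    using a b c d by (simp_all flip: assoc)
  then have "mul S (mul S a c) (mul S d b) = e" "mul S (mul S d b) (mul S a c) = e"
    using a b c d by (simp_all add: assoc)
  moreover have "mul S e (mul S a c) = mul S a c" "mul S e (mul S d b) = mul S d b"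
    using a b c d assms(3) by (simp_all flip: assoc)
  moreover have "mul S (mul S a c) e = mul S a c" "mul S (mul S d b) e = mul S d b"
    using a b c d assms(3) by (simp_all add: assoc)
  ultimately show ?thesis
    using a b c d by (intro units_atI[where b = "mul S d b"]) auto
qed

lemma group_units_at:
  assumes e: "e \<in> carrier S" "mul S e e = e"
  shows "group (group_on S (units_at e) e)"
proof (rule groupI, simp_all)
  show "e \<in> units_at e"
    using e by (intro units_atI[where b = e])
  fix a assume a: "a \<in> units_at e"
  then show "mul S e a = a"
    by (simp add: units_at_def)
  show "\<exists>b\<in>units_at e. mul S b a = e"
    using a unfolding units_at_def by blast
  fix b assume b: "b \<in> units_at e"
  show "mul S a b \<in> units_at e"
    using a b e(1) by (rule mul_units_at)
  fix c assume "c \<in> units_at e"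
  with a b show "mul S (mul S a b) c = mul S a (mul S b c)"
    by (simp add: units_at_def assoc)
qed

lemma units_at_maximal:
  assumes e: "e \<in> carrier S" "mul S e e = e"
  shows "maximal_sg_subgroup S (units_at e) e"
  unfolding maximal_sg_subgroup_def
proof (intro conjI allI impI)
  show "sg_subgroup S (units_at e) e"
    using group_units_at[OF e] by (auto simp: sg_subgroup_def units_at_def)
  fix H f assume *: "sg_subgroup S H f \<and> units_at e \<subseteq> H"
  then interpret H: group "group_on S H f"
    by (simp add: sg_subgroup_def)
  have "e \<in> units_at e"
    using e by (intro units_atI[where b = e])
  then have eH: "e \<in> H"
    using * by blast
  then have ef: "e = f"
    using H.r_cancel_one[of e e] e(2) by simp
  show "H = units_at e"
  proof
    show "H \<subseteq> units_at e"
    proof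
      fix a assume a: "a \<in> H"
      define b where "b = inv\<^bsub>group_on S H f\<^esub> a"
      have b: "b \<in> H" "mul S a b = f" "mul S b a = f"
        using a H.inv_closed[of a] H.l_inv[of a] H.r_inv[of a] by (simp_all add: b_def)
      show "a \<in> units_at e"
        using a b * H.l_one[of a] H.r_one[of a] H.l_one[of b] H.r_one[of b]
        by (intro units_atI[where b = b]) (auto simp: ef sg_subgroup_def)
    qed
  qed (use * in blast)
qed

text \<open>The converse of \<open>epigroup_alg\<close> below, one element at a time. The exponent depends on the element.\<close>

lemma pseudoinverse_laws:
  assumes x: "x \<in> carrier S" and "is_pseudoinverse S x y"
  shows "y \<in> carrier S \<and> mul S x y = mul S y x \<and> mul S (mul S x y) y = y \<and>
    (\<exists>n. mul S (power_Suc S x n) (mul S x y) = power_Suc S x n)"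
proof -
  obtain n G e where G: "sg_subgroup S G e" and n: "power_Suc S x n \<in> G" and xe: "mul S x e \<in> G"
    and y: "y = inv\<^bsub>group_on S G e\<^esub> (mul S x e)"
    using assms unfolding is_pseudoinverse_def maximal_sg_subgroup_def by blast
  interpret G: group "group_on S G e"
    using G by (simp add: sg_subgroup_def)
  have G_S: "a \<in> carrier S" if "a \<in> G" for a
    using that G by (auto simp: sg_subgroup_def)
  have e: "e \<in> G"
    using G.one_closed by simp
  have yG: "y \<in> G" and xey: "mul S (mul S x e) y = e" and yxe: "mul S y (mul S x e) = e"
    using xe y G.inv_closed[of "mul S x e"] G.r_inv[of "mul S x e"] G.l_inv[of "mul S x e"] by simp_all
  have unit: "mul S e a = a" "mul S a e = a" if "a \<in> G" for a
    using that G.l_one[of a] G.r_one[of a] by simp_all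
  note S = x G_S[OF e] G_S[OF yG] G_S[OF n]
  have xy: "mul S x y = e"
    using xey S unit[OF yG] by (simp add: assoc)
  have exe: "mul S e (mul S x e) = mul S x e"
    using unit[OF xe] by simp
  \<comment> \<open>A power of \<open>x\<close> is invertible in \<open>G\<close> and commutes with \<open>x\<close>, which makes \<open>e\<close> commute with \<open>x\<close>.\<close>
  define g where "g = inv\<^bsub>group_on S G e\<^esub> (power_Suc S x n)"
  have g: "g \<in> G" "mul S g (power_Suc S x n) = e"
    using n G.inv_closed[of "power_Suc S x n"] G.l_inv[of "power_Suc S x n"] by (simp_all add: g_def)
  have "mul S e x = mul S g (mul S x (power_Suc S x n))"
    using g(2) S G_S[OF g(1)] by (simp add: power_commute flip: assoc)
  also have "\<dots> = mul S g (mul S x (mul S (power_Suc S x n) e))"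
    using unit[OF n] by simp
  also have "\<dots> = mul S (mul S g (mul S (power_Suc S x n) x)) e"
    using S G_S[OF g(1)] by (simp add: assoc flip: power_commute)
  also have "\<dots> = mul S e (mul S x e)"
    using g(2) S G_S[OF g(1)] by (simp flip: assoc)
  finally have ex: "mul S e x = mul S x e"
    using exe by simp
  have "mul S y x = mul S (mul S y e) x"
    using unit[OF yG] by simp
  also have "\<dots> = e"
    using S ex yxe by (simp add: assoc)
  finally have yx: "mul S y x = e" .
  show ?thesis
    using S xy yx unit[OF yG] unit[OF n] by auto
qed

end

locale epi_algebra = semigroup_algebra S for S :: "'a alg21" +
  fixes k :: nat
  assumes comm: "\<And>x. x \<in> carrier S \<Longrightarrow> mul S x (uop S x) = mul S (uop S x) x"
    and absorb: "\<And>x. x \<in> carrier S \<Longrightarrow> mul S (mul S x (uop S x)) (uop S x) = uop S x"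
    and power_fix: "\<And>x. x \<in> carrier S \<Longrightarrow> mul S (power_Suc S x k) (mul S x (uop S x)) = power_Suc S x k"
begin

lemma idem:
  assumes "x \<in> carrier S"
  shows "mul S (mul S x (uop S x)) (mul S x (uop S x)) = mul S x (uop S x)"
proof -
  have "mul S (mul S x (uop S x)) (mul S x (uop S x)) = mul S (mul S x (uop S x)) (mul S (uop S x) x)"
    using assms by (simp add: comm)
  also have "\<dots> = mul S (uop S x) x"
    using assms by (simp add: absorb flip: assoc)
  finally show ?thesis
    using assms by (simp add: comm)
qed

text \<open>The group \<open>G\<^sub>x\<close> is the group of units at the idempotent \<open>mul S x (uop S x)\<close>.\<close>

lemma epigroup_alg: "epigroup_alg S"
proof -
  have "\<exists>G e. maximal_sg_subgroup S G e \<and> power_Suc S x k \<in> G \<and> mul S x e \<in> G \<and>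
      uop S x = inv\<^bsub>group_on S G e\<^esub> (mul S x e)" if x: "x \<in> carrier S" for x
  proof -
    define e where "e = mul S x (uop S x)"
    have e: "e \<in> carrier S" "mul S e e = e"
      using x idem[OF x] by (simp_all add: e_def)
    have "mul S e x = mul S x (mul S (uop S x) x)"
      using x by (simp add: e_def assoc)
    then have ex: "mul S e x = mul S x e"
      using x by (simp add: e_def comm)
    have ey: "mul S e (uop S x) = uop S x"
      using x by (simp add: e_def absorb)
    have "mul S (uop S x) e = mul S (mul S (uop S x) x) (uop S x)"
      using x by (simp add: e_def assoc)
    then have ye: "mul S (uop S x) e = uop S x"
      using x by (simp add: absorb flip: comm)
    have exe: "mul S e (mul S x e) = mul S x e"
      using e x by (simp add: ex flip: assoc) (simp add: assoc)
    have xey: "mul S (mul S x e) (uop S x) = e"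
      using x e(1) ey by (simp add: assoc) (simp add: e_def)
    have "mul S (uop S x) x = e"
      using x by (simp add: e_def comm)
    then have yxe: "mul S (uop S x) (mul S x e) = e"
      using x e by (simp flip: assoc)
    have xee: "mul S (mul S x e) e = mul S x e"
      using x e by (simp add: assoc)
    have xe: "mul S x e \<in> units_at e"
      by (rule units_atI[OF _ _ exe xee ey ye xey yxe]) (use x e in simp_all)
    have y: "uop S x \<in> units_at e"
      by (rule units_atI[OF _ _ ey ye exe xee yxe xey]) (use x e in simp_all)
    have "mul S (power_Suc S x n) e \<in> units_at e" for n
    proof (induction n)
      case (Suc n)
      have "mul S (power_Suc S x (Suc n)) e = mul S (mul S (power_Suc S x n) e) (mul S x e)"
        using x e exe by (simp add: assoc)
      then show ?case
        using mul_units_at[OF Suc xe e(1)] by simp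
    qed (simp add: xe)
    then have "mul S (power_Suc S x k) e \<in> units_at e" .
    then have xk: "power_Suc S x k \<in> units_at e"
      using power_fix[OF x] by (simp add: e_def)
    interpret G: group "group_on S (units_at e) e"
      by (rule group_units_at[OF e])
    have "uop S x = inv\<^bsub>group_on S (units_at e) e\<^esub> (mul S x e)"
      using G.inv_equality[of "uop S x" "mul S x e"] xe y yxe by simp
    with xk xe units_at_maximal[OF e] show ?thesis by blast
  qed
  then have *: "\<forall>x\<in>carrier S. \<exists>G e. maximal_sg_subgroup S G e \<and> power_Suc S x k \<in> G \<and>
      mul S x e \<in> G \<and> uop S x = inv\<^bsub>group_on S G e\<^esub> (mul S x e)"
    by blast
  have "epigroup S"
    unfolding epigroup_def semigroup_alg_def using alg assoc *
    by (metis maximal_sg_subgroup_def)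
  moreover have "\<forall>x\<in>carrier S. is_pseudoinverse S x (uop S x)"
    using * unfolding is_pseudoinverse_def by blast
  ultimately show ?thesis
    by (simp add: epigroup_alg_def)
qed

end

lemma Models_epi_axioms_iff: "S \<in> Models (epi_axioms k) \<longleftrightarrow> epi_algebra S k"
proof
  assume S: "S \<in> Models (epi_axioms k)"
  have sat: "satisfies S p" if "p \<in> epi_axioms k" for p
    using that S by (simp add: Models_def)
  have alg: "algebra21 S"
    using S by (simp add: Models_def)
  show "epi_algebra S k"
  proof
    fix x y z assume "x \<in> carrier S" "y \<in> carrier S" "z \<in> carrier S"
    then show "mul S (mul S x y) z = mul S x (mul S y z)"
      using sat[of "(Mul (Mul (Var 0) (Var 1)) (Var 2), Mul (Var 0) (Mul (Var 1) (Var 2)))"]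
      by (auto simp: epi_axioms_def satisfies_def
          dest!: spec[of _ "\<lambda>i. if i = 0 then x else if i = 1 then y else z"])
  next
    fix x assume "x \<in> carrier S"
    then show "mul S x (uop S x) = mul S (uop S x) x"
      using sat[of "(Mul (Var 0) (Uop (Var 0)), Mul (Uop (Var 0)) (Var 0))"]
      by (auto simp: epi_axioms_def satisfies_def dest!: spec[of _ "\<lambda>i. x"])
  next
    fix x assume "x \<in> carrier S"
    then show "mul S (mul S x (uop S x)) (uop S x) = uop S x"
      using sat[of "(Mul (Mul (Var 0) (Uop (Var 0))) (Uop (Var 0)), Uop (Var 0))"]
      by (auto simp: epi_axioms_def satisfies_def dest!: spec[of _ "\<lambda>i. x"])
  next
    fix x assume "x \<in> carrier S"
    then show "mul S (power_Suc S x k) (mul S x (uop S x)) = power_Suc S x k"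
      using sat[of "(Mul (power_term (Var 0) k) (Mul (Var 0) (Uop (Var 0))), power_term (Var 0) k)"]
      by (auto simp: epi_axioms_def satisfies_def eval_power_term dest!: spec[of _ "\<lambda>i. x"])
  qed (rule alg)
next
  assume "epi_algebra S k"
  then interpret epi_algebra S k .
  show "S \<in> Models (epi_axioms k)"
    using alg
    by (auto simp: Models_def epi_axioms_def satisfies_def eval_power_term intro: assoc comm absorb power_fix)
qed

text \<open>A class of epigroups that is closed under forming free algebras has a uniform exponent, namely the
one that works for the generator of the free algebra.\<close>

lemma (in eq_theory) epigroup_variety_Models_iff:
  "epigroup_variety (Models \<theta> :: 'a::infinite alg21 set) \<longleftrightarrow> (\<exists>k. epi_axioms k \<subseteq> \<theta>)"
proof
  assume "\<exists>k. epi_axioms k \<subseteq> \<theta>"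
  then obtain k where k: "epi_axioms k \<subseteq> \<theta>" ..
  have "epigroup_alg S" if "S \<in> Models \<theta>" for S :: "'a alg21"
  proof -
    have "epi_algebra S k"
      using that Models_antimono[OF k] Models_epi_axioms_iff by blast
    then show ?thesis by (rule epi_algebra.epigroup_alg)
  qed
  then show "epigroup_variety (Models \<theta> :: 'a alg21 set)"
    unfolding epigroup_variety_def variety_def by blast
next
  assume epi: "epigroup_variety (Models \<theta> :: 'a alg21 set)"
  obtain F :: "'a alg21" and q where Fq: "term_quotient \<theta> F q"
    using ex_term_quotient by blast
  note F = Fq[unfolded term_quotient_def]
  have ea: "epigroup_alg S" if "S \<in> Models \<theta>" for S :: "'a alg21"
    using epi that unfolding epigroup_variety_def by blast
  have sg: "semigroup_algebra S" if "S \<in> Models \<theta>" for S :: "'a alg21"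
    using ea[OF that]
    unfolding epigroup_alg_def epigroup_def semigroup_alg_def semigroup_algebra_def by blast
  have laws: "uop S x \<in> carrier S \<and> mul S x (uop S x) = mul S (uop S x) x \<and>
      mul S (mul S x (uop S x)) (uop S x) = uop S x \<and>
    (\<exists>n. mul S (power_Suc S x n) (mul S x (uop S x)) = power_Suc S x n)"
    if "S \<in> Models \<theta>" "x \<in> carrier S" for S :: "'a alg21" and x
    using semigroup_algebra.pseudoinverse_laws[OF sg[OF that(1)] that(2)] ea[OF that(1)] that(2)
    unfolding epigroup_alg_def by blast
  have pow: "power_Suc F (q t) n = q (power_term t n)" for t n
    using F by (induction n) simp_all
  \<comment> \<open>The exponent of the generator works for every element of every algebra in the variety.\<close>
  obtain k where "mul F (power_Suc F (q (Var 0)) k) (mul F (q (Var 0)) (uop F (q (Var 0))))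
      = power_Suc F (q (Var 0)) k"
    using laws[of F "q (Var 0)"] F by blast
  then have k: "(Mul (power_term (Var 0) k) (Mul (Var 0) (Uop (Var 0))), power_term (Var 0) k) \<in> \<theta>"
    using F by (simp add: pow)
  have "satisfies S p" if "p \<in> epi_axioms k" "S \<in> Models \<theta>" for p and S :: "'a alg21"
  proof -
    have "satisfies S (Mul (power_term (Var 0) k) (Mul (Var 0) (Uop (Var 0))), power_term (Var 0) k)"
      using k that(2) unfolding Models_def by blast
    moreover have "satisfies S (Mul (Mul (Var 0) (Var 1)) (Var 2), Mul (Var 0) (Mul (Var 1) (Var 2)))"
      using semigroup_algebra.assoc[OF sg[OF that(2)]] by (simp add: satisfies_def)
    moreover have "satisfies S (Mul (Var 0) (Uop (Var 0)), Mul (Uop (Var 0)) (Var 0))"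
      "satisfies S (Mul (Mul (Var 0) (Uop (Var 0))) (Uop (Var 0)), Uop (Var 0))"
      using laws[OF that(2)] by (simp_all only: satisfies_def eval_term.simps fst_conv snd_conv) blast+
    ultimately show ?thesis
      using that(1) unfolding epi_axioms_def by blast
  qed
  then have "epi_axioms k \<subseteq> Eq (Models \<theta> :: 'a alg21 set)"
    by (auto simp: Eq_def)
  then show "\<exists>k. epi_axioms k \<subseteq> \<theta>"
    unfolding Eq_Models by blast
qed

lemma (in eq_theory) epi_axioms_Suc:
  assumes "epi_axioms k \<subseteq> \<theta>"
  shows "epi_axioms (Suc k) \<subseteq> \<theta>"
proof -
  have "satisfies S p" if S: "S \<in> Models \<theta>" and p: "p \<in> epi_axioms (Suc k)" for S :: "nat alg21" and p
  proof -
    interpret epi_algebra S k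
      using S Models_antimono[OF assms] Models_epi_axioms_iff by blast
    have "mul S (power_Suc S x (Suc k)) (mul S x (uop S x)) = power_Suc S x (Suc k)"
      if "x \<in> carrier S" for x
    proof -
      have "power_Suc S x (Suc k) = mul S x (power_Suc S x k)"
        using that by (simp add: power_commute)
      then show ?thesis
        using that power_fix[OF that] by (simp add: assoc)
    qed
    then have "epi_algebra S (Suc k)"
      by unfold_locales (auto intro: comm absorb)
    then show ?thesis
      using p Models_epi_axioms_iff unfolding Models_def by blast
  qed
  then have "epi_axioms (Suc k) \<subseteq> Eq (Models \<theta> :: nat alg21 set)"
    by (auto simp: Eq_def)
  then show ?thesis
    using Eq_Models[where 'a = nat] by simp
qed

lemma (in eq_theory) epi_axioms_mono:
  "epi_axioms k \<subseteq> \<theta> \<Longrightarrow> k \<le> m \<Longrightarrow> epi_axioms m \<subseteq> \<theta>"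
  by (rotate_tac 1, induction m rule: dec_induct) (auto dest: epi_axioms_Suc)

section \<open>The lattice of epigroup varieties in terms of theories\<close>

definition epi_theory :: "(uterm \<times> uterm) set \<Rightarrow> bool" where
  "epi_theory \<theta> \<longleftrightarrow> eq_theory \<theta> \<and> (\<exists>k. epi_axioms k \<subseteq> \<theta>)"

lemma epigroup_variety_Models:
  "epi_theory \<theta> \<Longrightarrow> epigroup_variety (Models \<theta> :: 'a::infinite alg21 set)"
  by (simp add: epi_theory_def eq_theory.epigroup_variety_Models_iff)

lemma Models_Eq_epigroup_variety: "epigroup_variety X \<Longrightarrow> Models (Eq X) = X"
  by (simp add: epigroup_variety_def Models_Eq)

lemma epi_theory_Eq:
  fixes X :: "'a::infinite alg21 set"
  assumes "epigroup_variety X"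
  shows "epi_theory (Eq X)"
proof -
  have X: "variety X"
    using assms by (simp add: epigroup_variety_def)
  then show ?thesis
    using assms eq_theory.epigroup_variety_Models_iff[OF eq_theory_Eq_variety[OF X], where 'a = 'a]
    by (simp add: epi_theory_def eq_theory_Eq_variety Models_Eq)
qed

lemma epi_theory_Int:
  assumes "epi_theory \<theta>" "epi_theory \<eta>"
  shows "epi_theory (\<theta> \<inter> \<eta>)"
proof -
  have th: "eq_theory \<theta>" "eq_theory \<eta>"
    using assms by (simp_all add: epi_theory_def)
  obtain k m where km: "epi_axioms k \<subseteq> \<theta>" "epi_axioms m \<subseteq> \<eta>"
    using assms by (auto simp: epi_theory_def)
  have "epi_axioms (max k m) \<subseteq> \<theta>" "epi_axioms (max k m) \<subseteq> \<eta>"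
    using eq_theory.epi_axioms_mono[OF th(1) km(1), of "max k m"]
      eq_theory.epi_axioms_mono[OF th(2) km(2), of "max k m"] by simp_all
  then show ?thesis
    using assms eq_theory_Int unfolding epi_theory_def by blast
qed

lemma epi_theory_join:
  assumes "epi_theory \<theta>" "epi_theory \<eta>"
  shows "epi_theory ((\<theta> \<union> \<eta>)\<^sup>*)"
proof -
  obtain k where "epi_axioms k \<subseteq> \<theta>"
    using assms by (auto simp: epi_theory_def)
  then have "epi_axioms k \<subseteq> (\<theta> \<union> \<eta>)\<^sup>*"
    by blast
  then show ?thesis
    using assms eq_theory_join unfolding epi_theory_def by blast
qed

lemma Eq_Models_epi: "epi_theory \<theta> \<Longrightarrow> Eq (Models \<theta> :: 'a::infinite alg21 set) = \<theta>"
  by (simp add: epi_theory_def eq_theory.Eq_Models)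

lemma Eq_Models_Int_epi:
  "epi_theory \<theta> \<Longrightarrow> epi_theory \<eta> \<Longrightarrow>
    Eq (Models \<theta> \<inter> Models \<eta> :: 'a::infinite alg21 set) = (\<theta> \<union> \<eta>)\<^sup>*"
  by (simp add: epi_theory_def Eq_Models_join)

lemma join_EPI_Models:
  fixes X Y :: "'a::infinite alg21 set"
  assumes "epigroup_variety X" "epigroup_variety Y"
  shows "X \<squnion>\<^bsub>EPI\<^esub> Y = Models (Eq X \<inter> Eq Y)"
proof (rule join_EPI[OF assms])
  show "epigroup_variety (Models (Eq X \<inter> Eq Y) :: 'a alg21 set)"
    by (intro epigroup_variety_Models epi_theory_Int epi_theory_Eq assms)
  show "X \<subseteq> Models (Eq X \<inter> Eq Y)" "Y \<subseteq> Models (Eq X \<inter> Eq Y)"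
    using Models_antimono[of "Eq X \<inter> Eq Y"] Models_Eq_epigroup_variety assms by blast+
  fix Z :: "'a alg21 set" assume Z: "epigroup_variety Z" "X \<subseteq> Z" "Y \<subseteq> Z"
  then have "Eq Z \<subseteq> Eq X \<inter> Eq Y"
    by (simp add: Eq_antimono)
  then show "Models (Eq X \<inter> Eq Y) \<subseteq> Z"
    using Models_antimono Models_Eq_epigroup_variety[OF Z(1)] by blast
qed

text \<open>The lower-modular law, read in the dual lattice of theories.\<close>

lemma lower_modular_theory:
  fixes X :: "'a::infinite alg21 set"
  assumes lm: "lower_modular_element EPI X" and X: "epigroup_variety X"
    and y: "epi_theory y" "y \<subseteq> Eq X" and z: "epi_theory z"
  shows "(z \<union> y)\<^sup>* \<inter> Eq X = (z \<inter> Eq X \<union> y)\<^sup>*"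
proof -
  define Y Z where "Y = (Models y :: 'a alg21 set)" and "Z = (Models z :: 'a alg21 set)"
  have YZ: "epigroup_variety Y" "epigroup_variety Z"
    unfolding Y_def Z_def using y(1) z by (simp_all add: epigroup_variety_Models)
  have "X \<subseteq> Y"
    unfolding Y_def using Models_antimono[OF y(2)] Models_Eq_epigroup_variety[OF X] by blast
  then have "(Z \<sqinter>\<^bsub>EPI\<^esub> Y) \<squnion>\<^bsub>EPI\<^esub> X = (Z \<squnion>\<^bsub>EPI\<^esub> X) \<sqinter>\<^bsub>EPI\<^esub> Y"
    using lm YZ X unfolding lower_modular_element_def by (simp add: EPI_def)
  also have "Z \<sqinter>\<^bsub>EPI\<^esub> Y = Z \<inter> Y"
    using YZ by (simp add: meet_EPI)
  also have "(Z \<inter> Y) \<squnion>\<^bsub>EPI\<^esub> X = Models ((z \<union> y)\<^sup>* \<inter> Eq X)"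
    using YZ X y z by (simp add: join_EPI_Models epigroup_variety_Int Y_def Z_def Eq_Models_Int_epi)
  also have "Z \<squnion>\<^bsub>EPI\<^esub> X = Models (z \<inter> Eq X)"
    using YZ X y z by (simp add: join_EPI_Models Y_def Z_def Eq_Models_epi)
  also have "Models (z \<inter> Eq X) \<sqinter>\<^bsub>EPI\<^esub> Y = Models (z \<inter> Eq X) \<inter> Models y"
    using YZ X z by (simp add: meet_EPI epigroup_variety_Models epi_theory_Int epi_theory_Eq Y_def)
  finally have "Eq (Models ((z \<union> y)\<^sup>* \<inter> Eq X) :: 'a alg21 set)
      = Eq (Models (z \<inter> Eq X) \<inter> Models y :: 'a alg21 set)"
    by simp
  then show ?thesis
    using X y z
    by (simp add: Eq_Models_Int_epi Eq_Models_epi epi_theory_Int epi_theory_join epi_theory_Eq)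
qed

text \<open>The form in which lower modularity is applied: the chain \<open>p\<close>, \<open>q\<close>, \<open>q'\<close>, \<open>p'\<close> can be replaced by one whose
steps are taken in \<open>y\<close> or in \<open>z \<inter> Eq X\<close>. It has to leave \<open>A\<close>, and no step of \<open>y\<close> does. For
a suitable \<open>A\<close> and \<open>z\<close> this produces new identities of \<open>X\<close>.\<close>

lemma lower_modular_escape:
  fixes X :: "'a::infinite alg21 set"
  assumes lm: "lower_modular_element EPI X" and X: "epigroup_variety X"
    and y: "epi_theory y" "y \<subseteq> Eq X" and z: "epi_theory z"
    and "(p, q) \<in> z" "(q, q') \<in> y" "(q', p') \<in> z" "(p, p') \<in> Eq X"
    and A: "p \<in> A" "p' \<notin> A" "\<And>s t. s \<in> A \<Longrightarrow> (s, t) \<in> y \<Longrightarrow> t \<in> A"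
  shows "\<exists>s\<in>A. \<exists>t. t \<notin> A \<and> (s, t) \<in> z \<and> (s, t) \<in> Eq X"
proof (rule ccontr)
  assume neg: "\<not> ?thesis"
  have "(p, p') \<in> (z \<union> y)\<^sup>*"
    using assms(6-8) by (meson UnI1 UnI2 converse_rtrancl_into_rtrancl r_into_rtrancl)
  then have "(p, p') \<in> (z \<inter> Eq X \<union> y)\<^sup>*"
    using lower_modular_theory[OF lm X y z] assms(9) by blast
  then have "p' \<in> A"
    by induction (use A neg in blast)+
  with A show False by simp
qed

text \<open>Only one inclusion of the modular law, again read in the dual lattice, has content.\<close>

lemma modular_elementI:
  fixes X :: "'a::infinite alg21 set"
  assumes X: "epigroup_variety X"
    and mod: "\<And>y z. epi_theory y \<Longrightarrow> epi_theory z \<Longrightarrow> z \<subseteq> y \<Longrightarrow>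
      (Eq X \<union> z)\<^sup>* \<inter> y \<subseteq> (Eq X \<inter> y \<union> z)\<^sup>*"
  shows "modular_element EPI X"
  unfolding modular_element_def
proof (intro conjI ballI impI)
  show "X \<in> carrier EPI"
    using X by (simp add: EPI_def)
  fix Y Z :: "'a alg21 set"
  assume "Y \<in> carrier EPI" "Z \<in> carrier EPI" "Y \<sqsubseteq>\<^bsub>EPI\<^esub> Z"
  then have YZ: "epigroup_variety Y" "epigroup_variety Z" and "Y \<subseteq> Z"
    by (simp_all add: EPI_def)
  define v y z where "v = Eq X" and "y = Eq Y" and "z = Eq Z"
  have th: "epi_theory v" "epi_theory y" "epi_theory z"
    using X YZ by (simp_all add: v_def y_def z_def epi_theory_Eq)
  have M: "Models v = X" "Models y = Y" "Models z = Z"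
    using X YZ by (simp_all add: v_def y_def z_def Models_Eq_epigroup_variety)
  have zy: "z \<subseteq> y"
    unfolding y_def z_def using \<open>Y \<subseteq> Z\<close> by (rule Eq_antimono)
  have join: "X \<squnion>\<^bsub>EPI\<^esub> Y = Models (v \<inter> y)"
    using X YZ by (simp add: join_EPI_Models v_def y_def)
  have "(X \<squnion>\<^bsub>EPI\<^esub> Y) \<sqinter>\<^bsub>EPI\<^esub> Z = Models (v \<inter> y) \<inter> Models z"
    unfolding join using th YZ
    by (simp add: meet_EPI epigroup_variety_Models epi_theory_Int M)
  also have "\<dots> = Models ((v \<inter> y \<union> z)\<^sup>*)"
    using th by (simp add: Models_Int Models_join eq_theory_Int epi_theory_def)
  also have "\<dots> = Models ((v \<union> z)\<^sup>* \<inter> y)"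
  proof -
    have "(v \<inter> y \<union> z)\<^sup>* \<subseteq> (v \<union> z)\<^sup>*"
      by (rule rtrancl_mono) blast
    moreover have "(v \<inter> y \<union> z)\<^sup>* \<subseteq> y"
    proof
      interpret y: eq_theory y
        using th by (simp add: epi_theory_def)
      fix p assume "p \<in> (v \<inter> y \<union> z)\<^sup>*"
      then show "p \<in> y"
      proof (induction p)
        case (Pair s t)
        then show ?case
          by (induction) (use zy y.refl y.trans in blast)+
      qed
    qed
    moreover have "(v \<union> z)\<^sup>* \<inter> y \<subseteq> (v \<inter> y \<union> z)\<^sup>*"
      using mod[OF th(2,3) zy] by (simp add: v_def)
    ultimately have "(v \<inter> y \<union> z)\<^sup>* = (v \<union> z)\<^sup>* \<inter> y"
      by blast
    then show ?thesis by simp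
  qed
  also have "\<dots> = Models (Eq (X \<inter> Z) \<inter> Eq Y)"
    using th by (simp add: M y_def flip: Eq_Models_Int_epi[where 'a = 'a])
  also have "\<dots> = (X \<sqinter>\<^bsub>EPI\<^esub> Z) \<squnion>\<^bsub>EPI\<^esub> Y"
    using X YZ by (simp add: join_EPI_Models meet_EPI epigroup_variety_Int)
  finally show "(X \<squnion>\<^bsub>EPI\<^esub> Y) \<sqinter>\<^bsub>EPI\<^esub> Z = (X \<sqinter>\<^bsub>EPI\<^esub> Z) \<squnion>\<^bsub>EPI\<^esub> Y" .
qed

section \<open>Words and truncated theories\<close>

text \<open>Up to associativity, a term without the unary operation is the list of its letters. \<open>None\<close> stands for
a term in which the unary operation occurs.\<close>

primrec word :: "uterm \<Rightarrow> nat list option" where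
  "word (Var i) = Some [i]"
| "word (Mul s t) = (case word s of None \<Rightarrow> None | Some u \<Rightarrow> map_option (append u) (word t))"
| "word (Uop t) = None"

primrec vars :: "uterm \<Rightarrow> nat set" where
  "vars (Var i) = {i}"
| "vars (Mul s t) = vars s \<union> vars t"
| "vars (Uop t) = vars t"

lemma word_Mul_Some:
  "word (Mul s t) = Some w \<longleftrightarrow> (\<exists>u u'. word s = Some u \<and> word t = Some u' \<and> w = u @ u')"
  by (auto split: option.splits)

lemma word_not_Nil: "word t = Some w \<Longrightarrow> w \<noteq> []"
  by (induction t arbitrary: w) (auto split: option.splits)

lemma set_word: "word t = Some w \<Longrightarrow> set w = vars t"
  by (induction t arbitrary: w) (auto split: option.splits)

lemma vars_not_empty: "vars t \<noteq> {}"
  by (induction t) auto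

lemma vars_subst: "vars (subst \<sigma> t) = (\<Union>i\<in>vars t. vars (\<sigma> i))"
  by (induction t) auto

lemma subst_cong_vars: "(\<And>i. i \<in> vars t \<Longrightarrow> \<sigma> i = \<tau> i) \<Longrightarrow> subst \<sigma> t = subst \<tau> t"
  by (induction t) auto

lemma subst_Var: "subst Var t = t"
  by (induction t) auto

lemma word_subst_None: "word t = None \<Longrightarrow> word (subst \<sigma> t) = None"
  by (induction t) (auto split: option.splits)

lemma word_subst_None': "i \<in> vars t \<Longrightarrow> word (\<sigma> i) = None \<Longrightarrow> word (subst \<sigma> t) = None"
  by (induction t) (auto split: option.splits)

lemma word_subst_cong:
  "word s = word t \<Longrightarrow> word (subst \<sigma> s) = word (subst \<sigma> t)"
proof -
  have Some: "word (subst \<sigma> t) = Some (concat (map (\<lambda>i. the (word (\<sigma> i))) w))"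
    if "word t = Some w" "\<And>i. i \<in> set w \<Longrightarrow> word (\<sigma> i) \<noteq> None" for t w
    using that by (induction t arbitrary: w) (fastforce split: option.splits)+
  assume "word s = word t"
  then show ?thesis
  proof (cases "word t")
    case w: (Some w)
    show ?thesis
    proof (cases "\<exists>i\<in>set w. word (\<sigma> i) = None")
      case True
      then show ?thesis
        using \<open>word s = word t\<close> w set_word word_subst_None' by metis
    next
      case False
      then show ?thesis
        using Some[of s w] Some[of t w] \<open>word s = word t\<close> w by auto
    qed
  qed (simp add: word_subst_None)
qed

lemma word_subst_letters:
  assumes "word t = Some w" "\<And>i. i \<in> set w \<Longrightarrow> word (\<sigma> i) = Some [f i]"
  shows "word (subst \<sigma> t) = Some (map f w)"
  using assms by (induction t arbitrary: w) (auto split: option.splits)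

text \<open>A substitution never shortens a word, and it preserves the length only if it renames letters. So
in a theory in which all long words are equal to zero only renamings have to be considered.\<close>

lemma length_word_subst:
  assumes "word t = Some w" "word (subst \<sigma> t) = Some w'"
  shows "length w \<le> length w' \<and> (length w = length w' \<longrightarrow> (\<forall>i\<in>set w. length (the (word (\<sigma> i))) = 1))"
  using assms
proof (induction t arbitrary: w w')
  case (Var i)
  then show ?case
    using word_not_Nil[of "\<sigma> i" w'] by (cases w') auto
next
  case (Mul s t)
  then obtain u u' x x' where u: "word s = Some u" "word t = Some u'" "w = u @ u'"
    "word (subst \<sigma> s) = Some x" "word (subst \<sigma> t) = Some x'" "w' = x @ x'"
    unfolding subst.simps word_Mul_Some by blast
  show ?case
    using Mul.IH(1)[OF u(1,4)] Mul.IH(2)[OF u(2,5)] u(3,6) by auto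
qed auto

fun term_of_word :: "nat list \<Rightarrow> uterm" where
  "term_of_word [] = Var 0"
| "term_of_word [i] = Var i"
| "term_of_word (i # w) = Mul (Var i) (term_of_word w)"

locale epi_eq_theory = eq_theory +
  fixes k
  assumes epi: "epi_axioms k \<subseteq> \<theta>"
begin

lemma instance_of:
  assumes "(s, t) \<in> epi_axioms k"
  shows "(subst \<sigma> s, subst \<sigma> t) \<in> \<theta>"
  using assms epi subst by blast

lemma assoc: "(Mul (Mul r s) t, Mul r (Mul s t)) \<in> \<theta>"
  using instance_of[of _ _ "\<lambda>i. if i = 0 then r else if i = 1 then s else t"]
  by (fastforce simp: epi_axioms_def)

lemma to_term_of_word: "word t = Some w \<Longrightarrow> (t, term_of_word w) \<in> \<theta>"
proof (induction t arbitrary: w)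
  case (Mul s t)
  then obtain u u' where u: "word s = Some u" "word t = Some u'" "w = u @ u'"
    unfolding word_Mul_Some by blast
  have *: "(Mul (term_of_word a) (term_of_word b), term_of_word (a @ b)) \<in> \<theta>"
    if "a \<noteq> []" "b \<noteq> []" for a b
    using that
  proof (induction a rule: term_of_word.induct)
    case (2 i)
    then show ?case by (cases b) (auto intro: refl)
  next
    case (3 i j a)
    have "(Mul (Var i) (Mul (term_of_word (j # a)) (term_of_word b)), Mul (Var i) (term_of_word (j # a @ b))) \<in> \<theta>"
      using mul[OF refl 3(1)] 3(3) by simp
    then show ?case
      using trans[OF assoc] by simp
  qed simp
  show ?case
    using trans[OF mul[OF Mul.IH(1)[OF u(1)] Mul.IH(2)[OF u(2)]] *] u word_not_Nil by blast
qed (auto intro: refl)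

lemma same_word:
  assumes "word s = Some w" "word t = Some w"
  shows "(s, t) \<in> \<theta>"
  using to_term_of_word[OF assms(1)] to_term_of_word[OF assms(2)] sym trans by blast

end

lemma epi_eq_theoryE:
  assumes "epi_theory \<theta>"
  obtains k where "epi_eq_theory \<theta> k"
  using assms unfolding epi_theory_def epi_eq_theory_def epi_eq_theory_axioms_def by blast

text \<open>A term is zero (\<open>None\<close>) if it contains the unary operation or has more than \<open>L\<close> letters. Words with
fewer than \<open>L\<close> letters are left alone, and \<open>\<phi>\<close> decides about the words with exactly \<open>L\<close> letters.\<close>

definition trunc_nf :: "nat \<Rightarrow> (nat list \<Rightarrow> nat list option) \<Rightarrow> uterm \<Rightarrow> nat list option" where
  "trunc_nf L \<phi> t = (case word t of None \<Rightarrow> None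
     | Some w \<Rightarrow> if length w < L then Some w else if length w = L then \<phi> w else None)"

definition trunc :: "nat \<Rightarrow> (nat list \<Rightarrow> nat list option) \<Rightarrow> (uterm \<times> uterm) set" where
  "trunc L \<phi> = {(s, t). trunc_nf L \<phi> s = trunc_nf L \<phi> t}"

text \<open>Products of words of length \<open>L\<close> are zero, so compatibility of \<open>\<phi>\<close> with renamings is all that is
required for the kernel of \<open>trunc_nf L \<phi>\<close> to be an equational theory.\<close>

locale trunc_rewriting =
  fixes L :: nat and \<phi> :: "nat list \<Rightarrow> nat list option"
  assumes len: "length w = L \<Longrightarrow> \<phi> w = Some w' \<Longrightarrow> length w' = L \<and> set w' = set w"
    and rename_None: "length w = L \<Longrightarrow> \<phi> w = None \<Longrightarrow> \<phi> (map f w) = None"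
    and rename: "length w = L \<Longrightarrow> length w' = L \<Longrightarrow> \<phi> w = Some u \<Longrightarrow> \<phi> w' = Some u \<Longrightarrow>
      \<phi> (map f w) = \<phi> (map f w')"
begin

lemma nf_short:
  assumes "trunc_nf L \<phi> s = Some w" "length w < L"
  shows "word s = Some w"
  using assms len by (fastforce simp: trunc_nf_def split: option.splits if_splits)

lemma nf_subst_None:
  assumes "trunc_nf L \<phi> s = None"
  shows "trunc_nf L \<phi> (subst \<sigma> s) = None"
proof (cases "word (subst \<sigma> s)")
  case (Some w')
  then obtain w where w: "word s = Some w"
    using word_subst_None by (cases "word s") auto
  with assms have *: "length w \<ge> L" "length w = L \<Longrightarrow> \<phi> w = None"
    by (auto simp: trunc_nf_def split: if_splits)
  have le: "length w \<le> length w'" and letters: "length w = length w' \<Longrightarrow> \<forall>i\<in>set w. length (the (word (\<sigma> i))) = 1"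
    using length_word_subst[OF w Some] by auto
  show ?thesis
  proof (cases "length w' = L")
    case True
    have "word (\<sigma> i) = Some [hd (the (word (\<sigma> i)))]" if "i \<in> set w" for i
      using that letters True * le word_subst_None'[of i s \<sigma>] set_word[OF w] Some
      by (cases "word (\<sigma> i)") (auto simp: length_Suc_conv)
    then have "word (subst \<sigma> s) = Some (map (\<lambda>i. hd (the (word (\<sigma> i)))) w)"
      by (rule word_subst_letters[OF w])
    then show ?thesis
      using * le True rename_None by (auto simp: trunc_nf_def)
  qed (use Some le * in \<open>auto simp: trunc_nf_def\<close>)
qed (auto simp: trunc_nf_def)

lemma nf_subst_full:
  assumes s: "word s = Some w" and t: "word t = Some w'" and L: "length w = L" "length w' = L"
    and u: "\<phi> w = Some u" "\<phi> w' = Some u"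
  shows "trunc_nf L \<phi> (subst \<sigma> s) = trunc_nf L \<phi> (subst \<sigma> t)"
proof (cases "\<forall>i\<in>set w. \<exists>j. word (\<sigma> i) = Some [j]")
  case True
  then obtain f where f: "\<And>i. i \<in> set w \<Longrightarrow> word (\<sigma> i) = Some [f i]"
    by metis
  have "set w' = set w"
    using len u L by blast
  then have "word (subst \<sigma> s) = Some (map f w)" "word (subst \<sigma> t) = Some (map f w')"
    using word_subst_letters[OF s, of \<sigma> f] word_subst_letters[OF t, of \<sigma> f] f by simp_all
  then show ?thesis
    using L rename[OF L u] by (simp add: trunc_nf_def)
next
  case False
  then obtain i where i: "i \<in> set w" "\<And>j. word (\<sigma> i) \<noteq> Some [j]"
    by blast
  have "trunc_nf L \<phi> (subst \<sigma> r) = None" if r: "word r = Some x" "length x = L" "set x = set w" for r x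
  proof (cases "word (subst \<sigma> r)")
    case (Some x')
    have "length x \<noteq> length x'"
      using length_word_subst[OF r(1) Some] i r(3) word_subst_None'[of i r \<sigma>] set_word[OF r(1)] Some
      by (cases "word (\<sigma> i)") (auto simp: length_Suc_conv)
    then show ?thesis
      using length_word_subst[OF r(1) Some] r(2) Some by (auto simp: trunc_nf_def)
  qed (simp add: trunc_nf_def)
  moreover have "set w' = set w"
    using len u L by blast
  ultimately show ?thesis
    using s t L by simp
qed

lemma trunc_short:
  assumes "(s, t) \<in> trunc L \<phi>" "word s = Some w" "length w < L"
  shows "word t = Some w"
proof (rule nf_short)
  show "trunc_nf L \<phi> t = Some w"
    using assms by (simp add: trunc_def trunc_nf_def)
qed fact

lemma trunc_sym: "(s, t) \<in> trunc L \<phi> \<Longrightarrow> (t, s) \<in> trunc L \<phi>"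
  by (simp add: trunc_def)

lemma trunc_cases:
  assumes "(s, t) \<in> trunc L \<phi>"
  obtains "word s = word t" | "trunc_nf L \<phi> s = None" "trunc_nf L \<phi> t = None"
  | w w' u where "word s = Some w" "word t = Some w'" "length w = L" "length w' = L"
      "\<phi> w = Some u" "\<phi> w' = Some u"
proof (cases "trunc_nf L \<phi> s")
  case None
  then show thesis
    using assms that(2) by (simp add: trunc_def)
next
  case s: (Some u)
  then have t: "trunc_nf L \<phi> t = Some u"
    using assms by (simp add: trunc_def)
  show thesis
  proof (cases "length u < L")
    case True
    then show thesis
      using that(1) nf_short[OF s] nf_short[OF t] by simp
  next
    case False
    then show thesis
      using s t that(3) by (simp add: trunc_nf_def split: option.splits if_splits)
  qed
qed

lemma nf_Mul_None:
  assumes "\<not> ((\<exists>w. word s = Some w \<and> length w < L) \<and> (\<exists>w. word t = Some w \<and> length w < L))"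
  shows "trunc_nf L \<phi> (Mul s t) = None"
proof (cases "word (Mul s t)")
  case (Some w)
  then obtain u u' where u: "word s = Some u" "word t = Some u'" "w = u @ u'"
    unfolding word_Mul_Some by blast
  then have "length w > L"
    using assms word_not_Nil[OF u(1)] word_not_Nil[OF u(2)] by (auto simp: neq_Nil_conv)
  then show ?thesis
    using Some by (simp add: trunc_nf_def)
qed (simp add: trunc_nf_def)

lemma trunc_mul:
  assumes "(s, s') \<in> trunc L \<phi>" "(t, t') \<in> trunc L \<phi>"
  shows "(Mul s t, Mul s' t') \<in> trunc L \<phi>"
proof (cases "(\<exists>w. word s = Some w \<and> length w < L) \<and> (\<exists>w. word t = Some w \<and> length w < L)")
  case True
  then obtain u w where "word s = Some u" "length u < L" "word t = Some w" "length w < L"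
    by blast
  then have "word (Mul s t) = word (Mul s' t')"
    using trunc_short assms by simp
  then show ?thesis
    by (simp add: trunc_def trunc_nf_def)
next
  case False
  then have "\<not> ((\<exists>w. word s' = Some w \<and> length w < L) \<and> (\<exists>w. word t' = Some w \<and> length w < L))"
    using trunc_short[OF trunc_sym[OF assms(1)]] trunc_short[OF trunc_sym[OF assms(2)]] by blast
  then have "trunc_nf L \<phi> (Mul s t) = trunc_nf L \<phi> (Mul s' t')"
    using nf_Mul_None[OF False] nf_Mul_None[of s' t'] by simp
  then show ?thesis
    by (simp add: trunc_def)
qed

lemma trunc_subst:
  assumes "(s, t) \<in> trunc L \<phi>"
  shows "(subst \<sigma> s, subst \<sigma> t) \<in> trunc L \<phi>"
  using assms
proof (cases rule: trunc_cases)
  case 1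
  then have "word (subst \<sigma> s) = word (subst \<sigma> t)"
    by (rule word_subst_cong)
  then show ?thesis by (simp add: trunc_def trunc_nf_def)
next
  case 2
  then show ?thesis by (simp add: trunc_def nf_subst_None)
next
  case 3
  then have "trunc_nf L \<phi> (subst \<sigma> s) = trunc_nf L \<phi> (subst \<sigma> t)"
    by (rule nf_subst_full)
  then show ?thesis by (simp add: trunc_def)
qed

lemma epi_theory_trunc: "epi_theory (trunc L \<phi>)"
  unfolding epi_theory_def
proof (intro conjI exI)
  show "eq_theory (trunc L \<phi>)"
  proof
    show "(Uop s, Uop t) \<in> trunc L \<phi>" for s t
      by (simp add: trunc_def trunc_nf_def)
    show "(Mul s t, Mul s' t') \<in> trunc L \<phi>"
      if "(s, s') \<in> trunc L \<phi>" "(t, t') \<in> trunc L \<phi>" for s s' t t'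
      using that by (rule trunc_mul)
    show "(subst \<sigma> s, subst \<sigma> t) \<in> trunc L \<phi>" if "(s, t) \<in> trunc L \<phi>" for s t \<sigma>
      using that by (rule trunc_subst)
  qed (simp_all add: trunc_def)
  have "word (power_term (Var 0) n) = Some (replicate (Suc n) 0)" for n
    by (induction n) (auto simp: replicate_append_same)
  then show "epi_axioms L \<subseteq> trunc L \<phi>"
    by (simp add: epi_axioms_def trunc_def trunc_nf_def)
qed

end

section \<open>Identifying two words of a nilpotent semigroup\<close>

text \<open>Every image of \<open>b\<close> under a renaming, injective or not, becomes zero.\<close>

definition kill :: "nat list \<Rightarrow> nat list \<Rightarrow> nat list option" where
  "kill b w = (if \<exists>f. w = map f b then None else Some w)"

text \<open>Replaces \<open>b\<close> by \<open>a\<close>, consistently under renamings. A renaming that identifies letters may turn \<open>a\<close>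
into an instance of \<open>b\<close>, which would force further identifications; making all words with too
few letters zero prevents this.\<close>

definition glue :: "nat list \<Rightarrow> nat list \<Rightarrow> nat list \<Rightarrow> nat list option" where
  "glue a b w = (if card (set w) < card (set b) then None
     else if \<exists>f. w = map f b then Some (map (SOME f. w = map f b) a) else Some w)"

lemma trunc_rewriting_Some: "trunc_rewriting L Some"
  by unfold_locales auto

lemma trunc_rewriting_kill: "trunc_rewriting L (kill b)"
proof
  fix w :: "nat list" and f :: "nat \<Rightarrow> nat" assume "kill b w = None"
  then obtain g where "w = map g b"
    by (auto simp: kill_def split: if_splits)
  then have "map f w = map (f \<circ> g) b"
    by simp
  then show "kill b (map f w) = None"
    unfolding kill_def by auto
qed (auto simp: kill_def split: if_splits)

lemma glue_small: "card (set w) < card (set b) \<Longrightarrow> glue a b w = None"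
  by (simp add: glue_def)

lemma glue_instance:
  assumes "set a = set b" "card (set b) \<le> card (set (map f b))"
  shows "glue a b (map f b) = Some (map f a)"
proof -
  define g where "g = (SOME g. map f b = map g b)"
  have "map f b = map g b"
    unfolding g_def by (rule someI[of _ f]) simp
  then have "map g a = map f a"
    using assms(1) by simp
  then show ?thesis
    using assms(2) unfolding glue_def g_def by auto
qed

lemma glue_other: "card (set b) \<le> card (set w) \<Longrightarrow> \<forall>f. w \<noteq> map f b \<Longrightarrow> glue a b w = Some w"
  by (auto simp: glue_def)

lemma glue_cases:
  assumes "set a = set b" "glue a b w = Some u"
  obtains "card (set b) \<le> card (set w)" "u = w"
  | f where "card (set b) \<le> card (set w)" "w = map f b" "u = map f a"
proof -
  have le: "card (set b) \<le> card (set w)"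
    using assms(2) by (auto simp: glue_def split: if_splits)
  show thesis
  proof (cases "\<exists>f. w = map f b")
    case True
    then obtain f where f: "w = map f b" ..
    then show thesis
      using that(2)[of f] le assms glue_instance[OF assms(1), of f] by simp
  next
    case False
    then show thesis
      using that(1) le assms(2) by (simp add: glue_def)
  qed
qed

text \<open>A renaming either loses letters, and then all words concerned become zero, or it can be undone, and then
\<open>a\<close> does not become an instance of \<open>b\<close>.\<close>

lemma trunc_rewriting_glue:
  assumes len: "length a = L" "length b = L" and set: "set a = set b" and ab: "\<And>f. a \<noteq> map f b"
  shows "trunc_rewriting L (glue a b)"
proof
  fix w w' assume "length w = L" "glue a b w = Some w'"
  then show "length w' = L \<and> set w' = set w"
    using glue_cases[OF set] len set by (metis length_map set_map)
next
  have small: "glue a b (map f w) = None" if "card (set w) < card (set b)" for w and f :: "nat \<Rightarrow> nat"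
  proof (rule glue_small)
    show "card (set (map f w)) < card (set b)"
      using that card_image_le[of "set w" f] by simp
  qed
  fix w :: "nat list" and f :: "nat \<Rightarrow> nat" assume "glue a b w = None"
  then have "card (set w) < card (set b)"
    by (auto simp: glue_def split: if_splits)
  then show "glue a b (map f w) = None"
    by (rule small)
next
  have key: "glue a b (map f w) = glue a b (map f u)" if "glue a b w = Some u" for f :: "nat \<Rightarrow> nat" and w u
    using set that
  proof (cases rule: glue_cases)
    case (2 g)
    show ?thesis
    proof (cases "card (set b) \<le> card (set (map f w))")
      case True
      then have c: "card (set b) \<le> card (set (map (f \<circ> g) b))"
        using 2 by (simp add: image_comp)
      \<comment> \<open>The renaming \<open>f \<circ> g\<close> is injective on the letters of \<open>b\<close>, so it can be undone.\<close>
      have "card ((f \<circ> g) ` set b) = card (set b)"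
        using c card_image_le[of "set b" "f \<circ> g"] by simp
      then have inj: "inj_on (f \<circ> g) (set a)"
        using set by (simp add: eq_card_imp_inj_on)
      have "map (f \<circ> g) a \<noteq> map h b" for h
      proof
        assume "map (f \<circ> g) a = map h b"
        then have "map (inv_into (set a) (f \<circ> g)) (map (f \<circ> g) a)
            = map (inv_into (set a) (f \<circ> g) \<circ> h) b"
          by simp
        moreover have "map (inv_into (set a) (f \<circ> g)) (map (f \<circ> g) a) = a"
          unfolding map_map by (rule map_idI) (simp only: comp_apply[of "inv_into _ _"] inv_into_f_f[OF inj])
        ultimately show False
          using ab by metis
      qed
      then have "glue a b (map (f \<circ> g) a) = Some (map (f \<circ> g) a)"
        using c set by (intro glue_other) auto
      moreover have "glue a b (map (f \<circ> g) b) = Some (map (f \<circ> g) a)"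
        using set c by (rule glue_instance)
      ultimately show ?thesis
        using 2 by simp
    next
      case False
      moreover have "set (map f u) = set (map f w)"
        using 2 set by simp
      ultimately have "card (set (map f w)) < card (set b)" "card (set (map f u)) < card (set b)"
        by simp_all
      then show ?thesis
        by (simp only: glue_small)
    qed
  qed simp
  fix w w' u :: "nat list" and f :: "nat \<Rightarrow> nat" assume "glue a b w = Some u" "glue a b w' = Some u"
  then show "glue a b (map f w) = glue a b (map f w')"
    using key by simp
qed

section \<open>Terms with the unary operation in a lower-modular variety\<close>

locale lower_modular_variety =
  fixes X :: "'a::infinite alg21 set" and k :: nat
  assumes lm: "lower_modular_element EPI X" and variety: "epigroup_variety X"
    and index: "epi_axioms k \<subseteq> Eq X" and k_pos: "0 < k"
begin

sublocale epi_eq_theory "Eq X" k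
  using epi_theory_Eq[OF variety] index
  by (simp add: epi_theory_def epi_eq_theory_def epi_eq_theory_axioms_def)

text \<open>The chain \<open>s\<close>, \<open>t\<close>, \<open>t'\<close>, \<open>s'\<close>: its outer steps hold in the theory \<open>glue\<close>, where \<open>s'\<close> and \<open>t'\<close> are
zero, and the middle step holds in \<open>X\<close> and in the theory \<open>kill\<close>, where \<open>a\<close> stays isolated. In the
theory \<open>glue\<close> the word \<open>a\<close> is equal to \<open>b\<close> and to no other word.\<close>

lemma words_related:
  assumes ab: "length a = length b" "set a = set b" "\<And>f. a \<noteq> map f b"
    and s: "word s = Some a" "(s, s') \<in> Eq X" "word s' = None"
    and t: "word t = Some b" "(t, t') \<in> Eq X" "word t' = None"
  shows "(s, t) \<in> Eq X"
proof -
  define L where "L = length b"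
  have L: "length a = L" "length b = L"
    using ab by (simp_all add: L_def)
  interpret G: trunc_rewriting L "glue a b"
    using L ab by (intro trunc_rewriting_glue)
  interpret K: trunc_rewriting L "kill b"
    by (rule trunc_rewriting_kill)
  have a: "glue a b a = Some a"
    using ab by (intro glue_other) auto
  have b: "glue a b b = Some a"
    using glue_instance[of a b id] ab by simp
  have "\<exists>r\<in>{r. word r = Some a}. \<exists>r'. r' \<notin> {r. word r = Some a} \<and> (r, r') \<in> trunc L (glue a b) \<and> (r, r') \<in> Eq X"
  proof (rule lower_modular_escape[OF lm variety])
    show "epi_theory (trunc L (kill b) \<inter> Eq X)"
      by (intro epi_theory_Int K.epi_theory_trunc epi_theory_Eq variety)
    show "epi_theory (trunc L (glue a b))"
      by (rule G.epi_theory_trunc)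
    show "(s, t) \<in> trunc L (glue a b)"
      using s t L a b by (simp add: trunc_def trunc_nf_def)
    have "kill b b = None"
      unfolding kill_def by (metis list.map_id)
    then show "(t, t') \<in> trunc L (kill b) \<inter> Eq X"
      using t L by (simp add: trunc_def trunc_nf_def)
    show "(t', s') \<in> trunc L (glue a b)"
      using s t by (simp add: trunc_def trunc_nf_def)
    fix r r' assume r: "r \<in> {r. word r = Some a}" "(r, r') \<in> trunc L (kill b) \<inter> Eq X"
    have "kill b a = Some a"
      using ab by (simp add: kill_def)
    then have "trunc_nf L (kill b) r' = Some a"
      using r L by (simp add: trunc_def trunc_nf_def)
    then show "r' \<in> {r. word r = Some a}"
      using L by (auto simp: trunc_nf_def kill_def split: option.splits if_splits)
  qed (use s in auto)
  then obtain r r' where r: "word r = Some a" "word r' \<noteq> Some a" "(r, r') \<in> trunc L (glue a b)"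
    "(r, r') \<in> Eq X"
    by blast
  then have "trunc_nf L (glue a b) r' = Some a"
    using L a by (simp add: trunc_def trunc_nf_def)
  then obtain w where w: "word r' = Some w" "glue a b w = Some a" "w \<noteq> a"
    using r(2) L by (auto simp: trunc_nf_def split: option.splits if_splits)
  from ab(2) w(2) have "w = b"
  proof (cases rule: glue_cases)
    case (2 f)
    have "map f a = map id a"
      using 2 by simp
    then have "map f b = map id b"
      unfolding map_eq_conv using ab by simp
    then show ?thesis
      using 2 by simp
  qed (use w in simp)
  then have "(r', t) \<in> Eq X"
    using w t same_word by blast
  then show ?thesis
    using same_word[OF s(1) r(1)] r(4) trans by blast
qed

end

lemma word_power_term_Var: "word (power_term (Var i) n) = Some (replicate (Suc n) i)"
  by (induction n) (auto simp: replicate_append_same)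

lemma word_power_term_Mul_Var: "word (power_term (Mul (Var i) (Var j)) n) = Some (concat (replicate (Suc n) [i, j]))"
proof (induction n)
  case (Suc n)
  have "concat (replicate n [i, j]) @ [i, j] = i # j # concat (replicate n [i, j])"
    by (induction n) auto
  with Suc show ?case by simp
qed simp

text \<open>The positions \<open>m\<close> and \<open>n\<close> carry the two letters of \<open>b\<close> but the same letter of \<open>a\<close>, so a renaming of \<open>b\<close>
into \<open>a\<close> would identify the letters of \<open>b\<close>.\<close>

lemma not_instance_of_two_letters:
  assumes "a ! m = a ! n" "b ! m = 0" "b ! n = 1" "m < length b" "n < length b"
    and "set b = {0, 1}" "card (set a) = 2"
  shows "a \<noteq> map f (b :: nat list)"
proof
  assume a: "a = map f b"
  then have "f 0 = f 1"
    using assms(1-5) by simp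
  then have "set a = {f 0}"
    using a assms(6) by auto
  then show False
    using assms(7) by simp
qed

text \<open>By \<open>uop_absorb\<close> a factor \<open>uop S x\<close> turns every other factor \<open>y\<close> of a product into \<open>uop S y\<close>. The values of the pseudoinversion form a semilattice, and the value of a term
containing the unary operation is the meet of the values of \<open>uop\<close> at its variables.\<close>

locale central_epi_algebra = epi_algebra S k for S :: "'a alg21" and k +
  assumes uop_central: "x \<in> carrier S \<Longrightarrow> y \<in> carrier S \<Longrightarrow> mul S (uop S x) y = mul S y (uop S x)"
    and uop_mul: "x \<in> carrier S \<Longrightarrow> y \<in> carrier S \<Longrightarrow> uop S (mul S x y) = mul S (uop S x) (uop S y)"
    and uop_absorb: "x \<in> carrier S \<Longrightarrow> y \<in> carrier S \<Longrightarrow> mul S (uop S x) y = mul S (uop S x) (uop S y)"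
    and uop_idem: "x \<in> carrier S \<Longrightarrow> mul S (uop S x) (uop S x) = uop S x"
    and uop_uop: "x \<in> carrier S \<Longrightarrow> uop S (uop S x) = uop S x"
begin

context
  fixes v assumes v: "\<And>i::nat. v i \<in> carrier S"
begin

lemma ev_closed [simp]: "eval_term S v t \<in> carrier S"
  using alg v by (rule eval_closed)

lemma eval_not_word: "word t = None \<Longrightarrow> uop S (eval_term S v t) = eval_term S v t"
proof (induction t)
  case (Mul s t)
  show ?case
  proof (cases "word s")
    case None
    then have s: "uop S (eval_term S v s) = eval_term S v s"
      by (rule Mul.IH)
    then show ?thesis
      using uop_absorb[of "eval_term S v s" "eval_term S v t"] by (simp add: uop_mul uop_uop)
  next
    case (Some a)
    then have "word t = None"
      using Mul.prems by (cases "word t") auto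
    then have t: "uop S (eval_term S v t) = eval_term S v t"
      by (rule Mul.IH)
    have "mul S (eval_term S v s) (eval_term S v t) = mul S (uop S (eval_term S v t)) (eval_term S v s)"
      using t uop_central[of "eval_term S v t" "eval_term S v s"] by simp
    also have "\<dots> = mul S (uop S (eval_term S v t)) (uop S (eval_term S v s))"
      by (rule uop_absorb) simp_all
    also have "\<dots> = mul S (uop S (eval_term S v s)) (uop S (eval_term S v t))"
      by (rule uop_central) simp_all
    finally show ?thesis
      by (simp add: uop_mul uop_uop)
  qed
qed (simp_all add: uop_uop)

lemma absorb_var: "i \<in> vars t \<Longrightarrow>
  mul S (uop S (eval_term S v t)) (uop S (v i)) = uop S (eval_term S v t)"
proof (induction t)
  case (Mul s t)
  let ?s = "uop S (eval_term S v s)" and ?t = "uop S (eval_term S v t)" and ?i = "uop S (v i)"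
  have i: "v i \<in> carrier S"
    by (rule v)
  show ?case
  proof (cases "i \<in> vars t")
    case True
    then show ?thesis
      using Mul.IH(2) i by (simp add: uop_mul assoc)
  next
    case False
    then have s: "mul S ?s ?i = ?s"
      using Mul by simp
    have "mul S (mul S ?s ?t) ?i = mul S ?s (mul S ?i ?t)"
      using i uop_central[of "v i" ?t] by (simp add: assoc)
    also have "\<dots> = mul S ?s ?t"
      using i s by (simp flip: assoc)
    finally show ?thesis
      by (simp add: uop_mul)
  qed
qed (use v in \<open>simp_all add: uop_idem uop_uop\<close>)

lemma absorb_vars: "vars s \<subseteq> vars t \<Longrightarrow>
  mul S (uop S (eval_term S v t)) (uop S (eval_term S v s)) = uop S (eval_term S v t)"
proof (induction s)
  case (Mul s s')
  let ?t = "uop S (eval_term S v t)"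
  have "mul S ?t (uop S (eval_term S v (Mul s s')))
      = mul S (mul S ?t (uop S (eval_term S v s))) (uop S (eval_term S v s'))"
    by (simp add: uop_mul assoc)
  with Mul show ?case by simp
qed (simp_all add: absorb_var uop_uop)

lemma eval_same_vars:
  assumes "word s = None" "word t = None" "vars s = vars t"
  shows "eval_term S v s = eval_term S v t"
proof -
  have "uop S (eval_term S v t) = mul S (uop S (eval_term S v t)) (uop S (eval_term S v s))"
    using assms(3) by (simp add: absorb_vars)
  also have "\<dots> = mul S (uop S (eval_term S v s)) (uop S (eval_term S v t))"
    by (rule uop_central) simp_all
  also have "\<dots> = uop S (eval_term S v s)"
    using assms(3) by (simp add: absorb_vars)
  finally show ?thesis
    using assms(1,2) by (simp add: eval_not_word)
qed

end

end

context lower_modular_variety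
begin

lemma power_term_absorbs: "(power_term t k, Mul (power_term t k) (Mul t (Uop t))) \<in> Eq X"
  using instance_of[of "Mul (power_term (Var 0) k) (Mul (Var 0) (Uop (Var 0)))" "power_term (Var 0) k" "\<lambda>i. t"]
  by (intro sym[of _ "power_term t k"]) (simp add: epi_axioms_def subst_power_term)

lemma two_letter_identity:
  assumes "word s = Some a" "word t = Some b" "length a = length b" "set a = {0, 1}" "set b = {0, 1}"
    and "a ! m = a ! n" "b ! m = 0" "b ! n = 1" "m < length b" "n < length b"
    and "(s, s') \<in> Eq X" "word s' = None" "(t, t') \<in> Eq X" "word t' = None"
  shows "(s, t) \<in> Eq X"
proof (rule words_related[OF assms(3) _ _ assms(1,11,12) assms(2,13,14)])
  show "a \<noteq> map f b" for f
    using assms by (intro not_instance_of_two_letters[of a m n b]) simp_all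
qed (simp add: assms(4,5))

text \<open>The four identities behind \<open>central_epi_algebra\<close>. Both sides of each are words of the same length in
two letters that contain a power with exponent \<open>k + 1\<close>, so they equal terms with the unary operation. Positivity
of \<open>k\<close> ensures that the left side does not arise from the right side by renaming letters.\<close>

lemma identity_shift: "(Mul (power_term (Var 0) (Suc k)) (power_term (Var 1) k), Mul (power_term (Var 0) k) (power_term (Var 1) (Suc k))) \<in> Eq X"
proof (rule two_letter_identity)
  let ?x = "Var 0" and ?y = "Var 1"
  show "word (Mul (power_term ?x (Suc k)) (power_term ?y k)) = Some (replicate (k + 2) 0 @ replicate (k + 1) 1)"
    "word (Mul (power_term ?x k) (power_term ?y (Suc k))) = Some (replicate (k + 1) 0 @ replicate (k + 2) 1)"
    by (simp_all only: word_Mul_Some word_power_term_Var) simp_all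
  show "(Mul (power_term ?x (Suc k)) (power_term ?y k), Mul (power_term ?x (Suc k)) (Mul (power_term ?y k) (Mul ?y (Uop ?y)))) \<in> Eq X"
    by (rule mul[OF refl power_term_absorbs])
  show "(Mul (power_term ?x k) (power_term ?y (Suc k)), Mul (Mul (power_term ?x k) (Mul ?x (Uop ?x))) (power_term ?y (Suc k))) \<in> Eq X"
    by (rule mul[OF power_term_absorbs refl])
  show "(replicate (k + 2) 0 @ replicate (k + 1) 1) ! 0 = (replicate (k + 2) 0 @ replicate (k + 1) (1::nat)) ! (k + 1)"
    by (simp add: nth_append nth_replicate del: replicate_Suc)
  show "(replicate (k + 1) 0 @ replicate (k + 2) 1) ! (k + 1) = (1::nat)"
    by (simp only: nth_append) simp
qed (auto simp: word_power_term_Var word_power_term_Mul_Var set_replicate_conv_if split: if_splits)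

lemma identity_central: "(Mul (power_term (Var 0) k) (Var 1), Mul (Var 1) (power_term (Var 0) k)) \<in> Eq X"
proof (rule two_letter_identity)
  let ?x = "Var 0" and ?y = "Var 1"
  show "word (Mul (power_term ?x k) ?y) = Some (replicate (k + 1) 0 @ [1])"
    "word (Mul ?y (power_term ?x k)) = Some (1 # replicate (k + 1) 0)"
    by (simp_all add: word_power_term_Var)
  show "(Mul (power_term ?x k) ?y, Mul (Mul (power_term ?x k) (Mul ?x (Uop ?x))) ?y) \<in> Eq X"
    by (rule mul[OF power_term_absorbs refl])
  show "(Mul ?y (power_term ?x k), Mul ?y (Mul (power_term ?x k) (Mul ?x (Uop ?x)))) \<in> Eq X"
    by (rule mul[OF refl power_term_absorbs])
  show "(replicate (k + 1) 0 @ [1]) ! 1 = (replicate (k + 1) 0 @ [1::nat]) ! 0"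
    using k_pos by (simp add: nth_append)
qed (auto simp: word_power_term_Var word_power_term_Mul_Var set_replicate_conv_if split: if_splits)

lemma identity_mul: "(Mul (power_term (Var 0) k) (power_term (Var 1) k), power_term (Mul (Var 0) (Var 1)) k) \<in> Eq X"
proof (rule two_letter_identity)
  let ?x = "Var 0" and ?y = "Var 1"
  show "word (Mul (power_term ?x k) (power_term ?y k)) = Some (replicate (k + 1) 0 @ replicate (k + 1) 1)"
    by (simp add: word_power_term_Var)
  show "word (power_term (Mul ?x ?y) k) = Some (concat (replicate (Suc k) [0, 1]))"
    by (rule word_power_term_Mul_Var)
  show "(Mul (power_term ?x k) (power_term ?y k), Mul (power_term ?x k) (Mul (power_term ?y k) (Mul ?y (Uop ?y)))) \<in> Eq X"
    by (rule mul[OF refl power_term_absorbs])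
  show "(power_term (Mul ?x ?y) k, Mul (power_term (Mul ?x ?y) k) (Mul (Mul ?x ?y) (Uop (Mul ?x ?y)))) \<in> Eq X"
    by (rule power_term_absorbs)
  show "(replicate (k + 1) 0 @ replicate (k + 1) 1) ! 0 = (replicate (k + 1) 0 @ replicate (k + 1) (1::nat)) ! 1"
    using k_pos by (simp add: nth_append)
  show "length (replicate (k + 1) 0 @ replicate (k + 1) 1) = length (concat (replicate (Suc k) [0, 1]))"
    by (simp add: length_concat sum_list_replicate)
qed (auto simp: word_power_term_Var word_power_term_Mul_Var set_replicate_conv_if split: if_splits)

lemma identity_absorb: "(Mul (power_term (Var 0) (k + k)) (Var 1), Mul (power_term (Var 0) k) (power_term (Var 1) k)) \<in> Eq X"
proof (rule two_letter_identity)
  let ?x = "Var 0" and ?y = "Var 1"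
  show "word (Mul (power_term ?x (k + k)) ?y) = Some (replicate (k + k + 1) 0 @ [1])"
    "word (Mul (power_term ?x k) (power_term ?y k)) = Some (replicate (k + 1) 0 @ replicate (k + 1) 1)"
    by (simp_all add: word_power_term_Var)
  have "(power_term ?x (k + n), Mul (power_term ?x (k + n)) (Mul ?x (Uop ?x))) \<in> Eq X" for n
    using epi_axioms_mono[OF epi, of "k + n"] by (intro sym[of _ "power_term ?x (k + n)"]) (auto simp: epi_axioms_def)
  then show "(Mul (power_term ?x (k + k)) ?y, Mul (Mul (power_term ?x (k + k)) (Mul ?x (Uop ?x))) ?y) \<in> Eq X"
    by (rule mul[OF _ refl])
  show "(Mul (power_term ?x k) (power_term ?y k), Mul (power_term ?x k) (Mul (power_term ?y k) (Mul ?y (Uop ?y)))) \<in> Eq X"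
    by (rule mul[OF refl power_term_absorbs])
  show "(replicate (k + k + 1) 0 @ [1]) ! 0 = (replicate (k + k + 1) 0 @ [1::nat]) ! (k + 1)"
    using k_pos by (simp add: nth_append)
  show "(replicate (k + 1) 0 @ replicate (k + 1) 1) ! (k + 1) = (1::nat)"
    by (simp only: nth_append) simp
qed (auto simp: word_power_term_Var word_power_term_Mul_Var set_replicate_conv_if split: if_splits)

lemma satisfied:
  assumes "(s, t) \<in> Eq X" "S \<in> X" "\<And>i. v i \<in> carrier S"
  shows "eval_term S v s = eval_term S v t"
  using assms by (fastforce simp: Eq_def satisfies_def)

lemma epi_algebra: "S \<in> X \<Longrightarrow> epi_algebra S k"
  using Models_antimono[OF index] Models_epi_axioms_iff Models_Eq_epigroup_variety[OF variety] by blast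

text \<open>Putting the idempotent \<open>mul S x (uop S x)\<close> for the second variable of \<open>identity_shift\<close> shows that
powers with exponent above \<open>k\<close> all coincide, so subgroups are trivial and \<open>uop S x\<close> is such a
power. The remaining identities then become statements about \<open>uop\<close>.\<close>

lemma central_epi_algebra:
  assumes S: "S \<in> X"
  shows "central_epi_algebra S k"
proof -
  interpret epi_algebra S k
    using S by (rule epi_algebra)
  let ?p = "\<lambda>x. power_Suc S x k"
  have id2: "eval_term S (\<lambda>i. if i = 0 then x else y) s = eval_term S (\<lambda>i. if i = 0 then x else y) t"
    if "(s, t) \<in> Eq X" "x \<in> carrier S" "y \<in> carrier S" for s t x y
    using that by (intro satisfied[OF _ S]) auto
  have shift: "mul S (mul S (?p x) x) (?p y) = mul S (?p x) (mul S (?p y) y)"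
    if "x \<in> carrier S" "y \<in> carrier S" for x y
    using id2[OF identity_shift that] by (simp add: eval_power_term)
  have e_pow: "power_Suc S e n = e" if "mul S e e = e" for e n
    using that by (induction n) auto
  have p_fix: "mul S (?p x) x = ?p x" if x: "x \<in> carrier S" for x
  proof -
    let ?e = "mul S x (uop S x)"
    have "mul S (mul S (?p x) x) ?e = mul S (?p x) ?e"
      using shift[of x ?e] x by (simp add: e_pow idem)
    also have "\<dots> = ?p x"
      using x by (rule power_fix)
    also have "mul S (mul S (?p x) x) ?e = mul S (?p x) (mul S x (mul S (uop S x) x))"
      using x comm[OF x] by (simp add: assoc)
    also have "\<dots> = mul S (mul S (?p x) ?e) x"
      using x by (simp add: assoc)
    finally show ?thesis
      using x by (simp add: power_fix)
  qed
  have uop_p: "uop S x = ?p x" and e_p: "mul S x (uop S x) = ?p x" if x: "x \<in> carrier S" for x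
  proof -
    have p_uop: "mul S (?p x) (uop S x) = ?p x"
      using power_fix[OF x] p_fix[OF x] x by (simp flip: assoc)
    have p_pow: "mul S (?p x) (power_Suc S (uop S x) n) = ?p x" for n
      using p_uop x by (induction n) (simp_all flip: assoc)
    have ey: "mul S (mul S x (uop S x)) (power_Suc S (uop S x) n) = power_Suc S (uop S x) n" for n
      using x by (induction n) (simp_all add: absorb flip: assoc)
    have "mul S (power_Suc S x n) (power_Suc S (uop S x) n) = mul S x (uop S x)" for n
    proof (induction n)
      case (Suc n)
      have "mul S (power_Suc S x (Suc n)) (power_Suc S (uop S x) (Suc n))
          = mul S (power_Suc S x n) (mul S (mul S x (uop S x)) (power_Suc S (uop S x) n))"
        using x by (simp add: assoc power_commute)
      then show ?case
        using Suc ey by simp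
    qed simp
    then show e: "mul S x (uop S x) = ?p x"
      using p_pow[of k] by simp
    then show "uop S x = ?p x"
      using absorb[OF x] p_uop by simp
  qed
  have idem': "mul S (?p x) (?p x) = ?p x" if "x \<in> carrier S" for x
    using idem[OF that] e_p[OF that] by simp
  have long: "power_Suc S x (k + n) = ?p x" if "x \<in> carrier S" for x n
    using p_fix[OF that] by (induction n) auto
  show ?thesis
  proof
    fix x assume x: "x \<in> carrier S"
    show "mul S (uop S x) (uop S x) = uop S x"
      using x by (simp add: uop_p idem')
    show "uop S (uop S x) = uop S x"
      using x by (simp add: uop_p e_pow idem')
    fix y assume y: "y \<in> carrier S"
    show "mul S (uop S x) y = mul S y (uop S x)"
      using id2[OF identity_central x y] x by (simp add: eval_power_term uop_p)
    show "uop S (mul S x y) = mul S (uop S x) (uop S y)"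
      using id2[OF identity_mul x y] x y by (simp add: eval_power_term uop_p)
    show "mul S (uop S x) y = mul S (uop S x) (uop S y)"
      using id2[OF identity_absorb x y] x y long by (simp add: eval_power_term uop_p)
  qed
qed

lemma nonword_same_vars:
  assumes "word s = None" "word t = None" "vars s = vars t"
  shows "(s, t) \<in> Eq X"
  using central_epi_algebra.eval_same_vars[OF central_epi_algebra _ assms]
  by (simp add: Eq_def satisfies_def)

end

text \<open>The identities that hold in semilattices are the regular ones.\<close>

definition regular :: "(uterm \<times> uterm) set \<Rightarrow> bool" where
  "regular \<theta> \<longleftrightarrow> (\<forall>(s, t)\<in>\<theta>. vars s = vars t)"

lemma (in eq_theory) irregular_witness:
  assumes "\<not> regular \<theta>"
  obtains p q i where "(p, q) \<in> \<theta>" "i \<in> vars q" "i \<notin> vars p"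
proof -
  obtain s t where "(s, t) \<in> \<theta>" "vars s \<noteq> vars t"
    using assms unfolding regular_def by blast
  then show thesis
    using that[of s t] that[of t s] sym by blast
qed

text \<open>If a variable occurs on one side only of some identity of \<open>X\<close>, then substituting \<open>r'\<close> for it and \<open>r\<close> for
the other variables makes \<open>r\<close> absorb \<open>r'\<close>; by symmetry \<open>r\<close> and \<open>r'\<close> are equal.\<close>

lemma (in lower_modular_variety) nonwords_related:
  assumes "word s = None" "word t = None" "vars s = vars t \<or> \<not> regular (Eq X)"
  shows "(s, t) \<in> Eq X"
proof (cases "regular (Eq X)")
  case True
  then show ?thesis
    using assms nonword_same_vars by blast
next
  case False
  then obtain p q i where pq: "(p, q) \<in> Eq X" "i \<in> vars q" "i \<notin> vars p"
    by (rule irregular_witness)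
  have *: "(r, Mul r r') \<in> Eq X" if r: "word r = None" "word r' = None" for r r'
  proof -
    define \<sigma> where "\<sigma> j = (if j = i then r' else r)" for j
    have p: "vars (subst \<sigma> p) = vars r"
      using pq(3) vars_not_empty[of p] by (auto simp: vars_subst \<sigma>_def split: if_splits)
    have q: "vars r' \<subseteq> vars (subst \<sigma> q)" "vars (subst \<sigma> q) \<subseteq> vars r \<union> vars r'"
      using pq(2) by (auto simp: vars_subst \<sigma>_def split: if_splits)
    have "(r, Mul r (subst \<sigma> p)) \<in> Eq X"
      using r p by (intro nonword_same_vars) auto
    moreover have "(Mul r (subst \<sigma> p), Mul r (subst \<sigma> q)) \<in> Eq X"
      by (intro mul refl subst pq)
    moreover have "(Mul r (subst \<sigma> q), Mul r r') \<in> Eq X"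
      using r q by (intro nonword_same_vars) auto
    ultimately show ?thesis
      by (meson trans)
  qed
  have "(Mul s t, Mul t s) \<in> Eq X"
    using assms by (intro nonword_same_vars) auto
  then show ?thesis
    using *[OF assms(1,2)] sym[OF *[OF assms(2,1)]] by (meson trans)
qed

section \<open>Nontrivial identities with a word on one side\<close>

text \<open>The group of maps \<open>x \<mapsto> p x + q\<close> with \<open>p \<noteq> 0\<close>, under composition.\<close>

definition affine :: "(rat \<times> rat) alg21" where
  "affine = \<lparr>carrier = {p. fst p \<noteq> 0},
     mul = \<lambda>p q. (fst p * fst q, fst p * snd q + snd p),
     uop = \<lambda>p. (1 / fst p, - snd p / fst p)\<rparr>"

lemma affine_simps [simp]:
  "p \<in> carrier affine \<longleftrightarrow> fst p \<noteq> 0"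
  "mul affine p q = (fst p * fst q, fst p * snd q + snd p)"
  "uop affine p = (1 / fst p, - snd p / fst p)"
  by (simp_all add: affine_def)

lemma regularD: "regular \<theta> \<Longrightarrow> (s, t) \<in> \<theta> \<Longrightarrow> vars s = vars t"
  unfolding regular_def by blast

lemma epi_algebra_affine: "epi_algebra affine 0"
proof
  have "(1, 0) \<in> carrier affine"
    by simp
  then have "carrier affine \<noteq> {}"
    by blast
  then show "algebra21 affine"
    by (auto simp: algebra21_def)
qed (auto simp: field_simps)

lemma epi_theory_affine: "epi_theory (Eq {affine})"
proof -
  have A: "affine \<in> Models (epi_axioms 0)"
    using epi_algebra_affine by (simp add: Models_epi_axioms_iff)
  then have "eq_theory (Eq {affine})"
    by (intro eq_theory_Eq) (simp add: Models_def)
  moreover have "epi_axioms 0 \<subseteq> Eq {affine}"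
    using A by (auto simp: Models_def Eq_def)
  ultimately show ?thesis
    unfolding epi_theory_def by blast
qed

text \<open>If the letter \<open>i\<close> denotes the map \<open>x \<mapsto> B x + i\<close>, then the value of a word is determined by its length
and by the number with the letters of the word as its digits in base \<open>B\<close>. For large \<open>B\<close> distinct
words have distinct values.\<close>

lemma eval_affine_word:
  assumes "word t = Some w"
  shows "eval_term affine (\<lambda>i. (of_nat B, of_nat i)) t
    = (of_nat B ^ length w, of_nat (horner_sum (\<lambda>i. i) B w))"
  using assms
proof (induction t arbitrary: w)
  case (Mul s t)
  then obtain u u' where u: "word s = Some u" "word t = Some u'" "w = u @ u'"
    unfolding word_Mul_Some by blast
  show ?case
    using Mul.IH(1)[OF u(1)] Mul.IH(2)[OF u(2)] u(3)
    by (simp add: power_add horner_sum_append)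
qed auto

lemma horner_sum_inject:
  assumes "length u = length w" "horner_sum (\<lambda>i. i) B u = horner_sum (\<lambda>i. i) B w"
    and "\<And>i. i \<in> set u \<union> set w \<Longrightarrow> i < (B :: nat)"
  shows "u = w"
  using assms
proof (induction u w rule: list_induct2)
  case (Cons i u j w)
  then have eq: "i + B * horner_sum (\<lambda>i. i) B u = j + B * horner_sum (\<lambda>i. i) B w" and lt: "i < B" "j < B"
    by simp_all
  have "i = j"
    using arg_cong[OF eq, of "\<lambda>n. n mod B"] lt by simp
  then show ?case
    using Cons eq lt by simp
qed simp

lemma affine_separates_words:
  assumes "(s, t) \<in> Eq {affine}" "word s = Some u" "word t = Some w"
  shows "u = w"
proof -
  \<comment> \<open>The base exceeds all letters, and it is at least 2 so that its powers determine their exponents.\<close>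
  define B where "B = sum_list (u @ w) + 2"
  have B: "i < B" if "i \<in> set u \<union> set w" for i
    using that member_le_sum_list[of i "u @ w"] by (auto simp: B_def)
  have "\<forall>i. (of_nat B, of_nat i) \<in> carrier affine"
    by (simp add: B_def)
  then have "eval_term affine (\<lambda>i. (of_nat B, of_nat i)) s = eval_term affine (\<lambda>i. (of_nat B, of_nat i)) t"
    using assms(1) unfolding Eq_def satisfies_def by fastforce
  then have eq: "(of_nat (B ^ length u) :: rat) = of_nat (B ^ length w)"
    "horner_sum (\<lambda>i. i) B u = horner_sum (\<lambda>i. i) B w"
    by (simp_all add: eval_affine_word[OF assms(2)] eval_affine_word[OF assms(3)])
  have "length u = length w"
    using eq(1) unfolding of_nat_eq_iff by (simp add: B_def)
  then show ?thesis
    using eq(2) B by (rule horner_sum_inject)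
qed

context lower_modular_variety
begin

text \<open>The chain \<open>s\<close>, \<open>s s\<^sup>-\<^sup>1 s\<close>, \<open>s' s'\<^sup>-\<^sup>1 s'\<close>, \<open>s'\<close>. Its middle step holds in \<open>X\<close> because the variables of \<open>s\<close> and
\<open>s'\<close> agree unless \<open>X\<close> is irregular. Since the affine group separates words, the step that leads away from
\<open>s\<close> ends in a term with the unary operation.\<close>

lemma collapse:
  assumes "(s, s') \<in> Eq X" "word s \<noteq> word s'"
  shows "\<exists>r. word r = None \<and> (s, r) \<in> Eq X"
proof (cases "word s")
  case None
  then show ?thesis using refl by blast
next
  case (Some a)
  \<comment> \<open>In a group \<open>c t\<close> equals \<open>t\<close>, although it contains the unary operation.\<close>
  define c where "c t = Mul (Mul t (Uop t)) t" for t
  have c_affine: "(t, c t) \<in> Eq {affine}" for t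
  proof -
    have "algebra21 affine"
      using epi_algebra_affine by (simp add: epi_algebra_def semigroup_algebra_def)
    then have "eval_term affine v t \<in> carrier affine" if "\<forall>i. v i \<in> carrier affine" for v
      using that by (intro eval_closed) auto
    then show ?thesis
      by (simp add: Eq_def satisfies_def c_def field_simps prod_eq_iff)
  qed
  have cw: "word (c t) = None" and cv: "vars (c t) = vars t" for t
    by (auto simp: c_def split: option.splits)
  interpret T: trunc_rewriting "length a" Some
    by (rule trunc_rewriting_Some)
  let ?y = "trunc (length a) Some"
  have "\<exists>r\<in>{r. word r = Some a}. \<exists>r'. r' \<notin> {r. word r = Some a} \<and> (r, r') \<in> Eq {affine} \<and> (r, r') \<in> Eq X"
  proof (rule lower_modular_escape[OF lm variety])
    show "epi_theory (?y \<inter> Eq X)"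
      by (intro epi_theory_Int T.epi_theory_trunc epi_theory_Eq variety)
    show "epi_theory (Eq {affine})"
      by (rule epi_theory_affine)
    show "(s, c s) \<in> Eq {affine}"
      by (rule c_affine)
    show "(c s', s') \<in> Eq {affine}"
      using c_affine[of s'] by (simp add: Eq_def satisfies_def)
    have "vars s = vars s' \<or> \<not> regular (Eq X)"
      using assms(1) by (auto simp: regular_def)
    then have "(c s, c s') \<in> Eq X"
      by (intro nonwords_related) (simp_all add: cw cv)
    then show "(c s, c s') \<in> ?y \<inter> Eq X"
      by (simp add: trunc_def trunc_nf_def cw)
    fix r r' assume "r \<in> {r. word r = Some a}" "(r, r') \<in> ?y \<inter> Eq X"
    then show "r' \<in> {r. word r = Some a}"
      by (auto simp: trunc_def trunc_nf_def split: option.splits if_splits)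
  qed (use assms Some in auto)
  then obtain r r' where r: "word r = Some a" "word r' \<noteq> Some a" "(r, r') \<in> Eq {affine}" "(r, r') \<in> Eq X"
    by blast
  have "word r' = None"
    using affine_separates_words[OF r(3,1)] r(2) by (cases "word r'") auto
  moreover have "(s, r') \<in> Eq X"
    using trans[OF same_word[OF Some r(1)] r(4)] .
  ultimately show ?thesis by blast
qed

text \<open>In a nil variety these are the terms that equal zero. In general they fall into one class for each set
of variables, or form a single class.\<close>

definition zeros :: "uterm set" where
  "zeros = {s. \<exists>r. word r = None \<and> (s, r) \<in> Eq X}"

lemma zeros_related:
  assumes "s \<in> zeros" "t \<in> zeros" "vars s = vars t \<or> \<not> regular (Eq X)"
  shows "(s, t) \<in> Eq X"
proof -
  obtain r r' where r: "word r = None" "(s, r) \<in> Eq X" and r': "word r' = None" "(t, r') \<in> Eq X"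
    using assms(1,2) unfolding zeros_def by blast
  have "vars r = vars r' \<or> \<not> regular (Eq X)"
    using assms(3) regularD[OF _ r(2)] regularD[OF _ r'(2)] by auto
  then have "(r, r') \<in> Eq X"
    using r r' by (intro nonwords_related)
  then show ?thesis
    using trans[OF r(2)] trans[OF _ sym[OF r'(2)]] by blast
qed

lemma zeros_subst: "s \<in> zeros \<Longrightarrow> subst \<sigma> s \<in> zeros"
  unfolding zeros_def using subst word_subst_None by blast

lemma related_cases:
  assumes "(s, t) \<in> Eq X"
  obtains w where "word s = Some w" "word t = Some w" | "s \<in> zeros" "t \<in> zeros"
proof (cases "word s = word t")
  case True
  show thesis
  proof (cases "word s")
    case None
    then have "s \<in> zeros" "t \<in> zeros"
      using True refl unfolding zeros_def by auto
    then show thesis by (rule that(2))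
  next
    case (Some w)
    then show thesis using True that(1) by simp
  qed
next
  case False
  then show thesis
    using that(2) collapse[OF assms] collapse[OF sym[OF assms]] by (simp add: zeros_def)
qed

end

section \<open>Modularity\<close>

text \<open>The terms \<open>Q g h\<close> for varying \<open>h\<close> are all equal modulo \<open>z\<close>, as each is equal to \<open>P g\<close>; they serve to
change the set of variables of a term.\<close>

lemma irregular_equalizer:
  assumes z: "eq_theory z" and "\<not> regular z"
  obtains P Q where "\<And>g h. (P g, Q g h) \<in> z" "\<And>g h. vars (P g) = vars g"
    and "\<And>g h. vars h \<subseteq> vars (Q g h)" "\<And>g h. vars (Q g h) \<subseteq> vars g \<union> vars h"
proof -
  obtain p q i where pq: "(p, q) \<in> z" "i \<in> vars q" "i \<notin> vars p"
    using eq_theory.irregular_witness[OF assms] by blast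
  define \<sigma> where "\<sigma> g h j = (if j = i then h else g)" for g h :: uterm and j
  have P: "subst (\<sigma> g h) p = subst (\<lambda>_. g) p" for g h
    using pq(3) by (intro subst_cong_vars) (auto simp: \<sigma>_def)
  show thesis
  proof
    show "(subst (\<lambda>_. g) p, subst (\<sigma> g h) q) \<in> z" for g h
      using eq_theory.subst[OF z pq(1), of "\<sigma> g h"] by (simp add: P)
    show "vars (subst (\<lambda>_. g) p) = vars g" for g
      using vars_not_empty[of p] by (simp add: vars_subst)
    show "vars h \<subseteq> vars (subst (\<sigma> g h) q)" for g h
      using pq(2) by (auto simp: vars_subst \<sigma>_def)
    show "vars (subst (\<sigma> g h) q) \<subseteq> vars g \<union> vars h" for g h
      by (auto simp: vars_subst \<sigma>_def split: if_splits)
  qed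
qed

text \<open>Take a chain of steps in \<open>Eq X\<close> and \<open>z\<close> that connects two terms related by \<open>y\<close>. A step in \<open>Eq X\<close> that is
not trivial connects two zeros, so the chain consists of steps in \<open>z\<close> before its first zero \<open>c\<close>
and after its last zero \<open>d\<close> (\<open>split\<close>). Because \<open>z \<subseteq> y\<close>, the zeros \<open>c\<close> and \<open>d\<close> are related by \<open>y\<close> (\<open>zeros\<close>),
and they are related by \<open>Eq X\<close> if \<open>X\<close> is irregular or their variables agree. The
difficult case is that of a regular \<open>X\<close> and an irregular \<open>z\<close>.\<close>

lemma (in lower_modular_variety) modular_inclusion:
  assumes y: "epi_theory y" and z: "epi_theory z" and zy: "z \<subseteq> y"
  shows "(Eq X \<union> z)\<^sup>* \<inter> y \<subseteq> (Eq X \<inter> y \<union> z)\<^sup>*"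
proof -
  let ?J = "(Eq X \<union> z)\<^sup>*" and ?R = "(Eq X \<inter> y \<union> z)\<^sup>*"
  interpret Y: eq_theory y
    using y by (simp add: epi_theory_def)
  obtain m where "epi_eq_theory z m"
    using z by (rule epi_eq_theoryE)
  then interpret Z: epi_eq_theory z m .
  interpret R: eq_theory ?R
    using y z by (intro eq_theory_join eq_theory_Int) (auto simp: epi_theory_def intro: eq_theory_axioms)
  have Ry: "(s, t) \<in> y" if "(s, t) \<in> ?R" for s t
    using that by induction (use zy Y.refl Y.trans in blast)+
  have both: "(c, d) \<in> ?R" if "c \<in> zeros" "d \<in> zeros" "(c, d) \<in> y" "vars c = vars d" for c d
    using that zeros_related by blast
  have irregular: "(c, d) \<in> ?R" if irr: "\<not> regular z" and cd: "c \<in> zeros" "d \<in> zeros" "(c, d) \<in> y" for c d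
  proof -
    obtain P Q where PQ: "\<And>g h. (P g, Q g h) \<in> z" "\<And>g h. vars (P g) = vars g"
      "\<And>g h. vars h \<subseteq> vars (Q g h)" "\<And>g h. vars (Q g h) \<subseteq> vars g \<union> vars h"
      by (rule irregular_equalizer[OF Z.eq_theory_axioms irr]) blast
    \<comment> \<open>The variables of \<open>d\<close> outside \<open>c\<close> may be replaced by arbitrary terms modulo \<open>y\<close>, because
      \<open>c\<close> is not affected; replacing them by \<open>Q g h\<close> leaves \<open>h\<close> free to be changed modulo \<open>z\<close>.\<close>
    define \<sigma> where "\<sigma> c g h = (\<lambda>i. if i \<in> vars c then Var i else Q g h)" for c g h
    have move: "(d, subst (\<sigma> c g h') d) \<in> ?R"
      if d: "d \<in> zeros" "(c, d) \<in> y" and v: "vars (subst (\<sigma> c g h) d) = vars d" for c d g h h'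
    proof -
      have "subst (\<sigma> c g h) c = c"
        using subst_cong_vars[of c "\<sigma> c g h" Var] by (simp add: \<sigma>_def subst_Var)
      then have "(c, subst (\<sigma> c g h) d) \<in> y"
        using Y.subst[OF d(2), of "\<sigma> c g h"] by simp
      then have "(d, subst (\<sigma> c g h) d) \<in> y"
        using Y.trans[OF Y.sym[OF d(2)]] by blast
      then have "(d, subst (\<sigma> c g h) d) \<in> ?R"
        using d(1) v by (intro both zeros_subst) auto
      moreover have "(subst (\<sigma> c g h) d, subst (\<sigma> c g h') d) \<in> z"
      proof (rule Z.subst_cong)
        fix i
        show "(\<sigma> c g h i, \<sigma> c g h' i) \<in> z"
          using Z.trans[OF Z.sym[OF PQ(1)] PQ(1)] Z.refl by (simp add: \<sigma>_def)
      qed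
      ultimately show ?thesis
        by (meson UnI2 rtrancl.rtrancl_into_rtrancl)
    qed
    have vars_\<sigma>: "vars (subst (\<sigma> c g h) d) = vars c \<inter> vars d \<union> vars (Q g h)"
      if "\<not> vars d \<subseteq> vars c" for c d g h
      using that by (auto simp: vars_subst \<sigma>_def split: if_splits)
    \<comment> \<open>If \<open>d\<close> has more variables than \<open>c\<close>, it is first rewritten with \<open>Q c d\<close>, which keeps its variables,
      and then with \<open>Q c c\<close>, which leaves just those of \<open>c\<close>.\<close>
    have larger: "(c, d) \<in> ?R" if cd: "c \<in> zeros" "d \<in> zeros" "(c, d) \<in> y" and sub: "vars c \<subseteq> vars d" for c d
    proof (cases "vars d \<subseteq> vars c")
      case True
      with that show ?thesis by (intro both) auto
    next
      case False
      have "vars (subst (\<sigma> c c d) d) = vars d"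
        using vars_\<sigma>[OF False] PQ(3)[of d c] PQ(4)[of c d] sub by auto
      then have 1: "(d, subst (\<sigma> c c c) d) \<in> ?R"
        by (rule move[OF cd(2,3)])
      have "vars (subst (\<sigma> c c c) d) = vars c"
        using vars_\<sigma>[OF False] PQ(3)[of c c] PQ(4)[of c c] by auto
      moreover have "(c, subst (\<sigma> c c c) d) \<in> y"
        using Y.trans[OF cd(3) Ry[OF 1]] .
      ultimately have "(c, subst (\<sigma> c c c) d) \<in> ?R"
        using cd by (intro both zeros_subst) auto
      then show ?thesis
        using R.trans[OF _ R.sym[OF 1]] by blast
    qed
    show ?thesis
    proof (cases "vars d \<subseteq> vars c")
      case True
      then show ?thesis
        using R.sym[OF larger[OF cd(2,1) Y.sym[OF cd(3)]]] by blast
    next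
      case False
      \<comment> \<open>Otherwise \<open>d\<close> is first enlarged by the variables of \<open>c\<close>.\<close>
      let ?d = "subst (\<sigma> c d (Mul c d)) d"
      have "vars (subst (\<sigma> c d d) d) = vars d"
        using vars_\<sigma>[OF False] PQ(3)[of d d] PQ(4)[of d d] by auto
      then have 1: "(d, ?d) \<in> ?R"
        by (rule move[OF cd(2,3)])
      have "vars c \<subseteq> vars ?d"
        using vars_\<sigma>[OF False] PQ(3)[of "Mul c d" d] by auto
      then have "(c, ?d) \<in> ?R"
        using cd Y.trans[OF cd(3) Ry[OF 1]] by (intro larger zeros_subst) auto
      then show ?thesis
        using R.trans[OF _ R.sym[OF 1]] by blast
    qed
  qed
  have zeros: "(c, d) \<in> ?R" if cd: "c \<in> zeros" "d \<in> zeros" "(c, d) \<in> y" "(c, d) \<in> ?J" for c d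
  proof (cases "regular (Eq X) \<and> regular z")
    case True
    have "vars c = vars d"
      using cd(4) by induction (use True regularD in blast)+
    then show ?thesis
      using cd by (intro both) auto
  next
    case False
    then show ?thesis
      using irregular cd zeros_related[OF cd(1,2)] by blast
  qed
  have split: "(s, t) \<in> z \<or> (\<exists>c\<in>zeros. \<exists>d\<in>zeros. (s, c) \<in> z \<and> (c, d) \<in> ?J \<and> (d, t) \<in> z)"
    if "(s, t) \<in> ?J" for s t
    using that
  proof induction
    case base
    show ?case using Z.refl by blast
  next
    case (step t r)
    show ?case
    proof (cases "(t, r) \<in> z")
      case True
      then show ?thesis
        using step.IH Z.trans by blast
    next
      case False
      then have tr: "(t, r) \<in> Eq X"
        using step by blast
      then show ?thesis
      proof (cases rule: related_cases)
        case (1 w)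
        then show ?thesis
          using False Z.same_word by blast
      next
        case 2
        from step.IH show ?thesis
        proof
          assume "(s, t) \<in> z"
          moreover have "(t, r) \<in> ?J"
            using tr by blast
          ultimately show ?thesis
            using 2 Z.refl by blast
        next
          assume "\<exists>c\<in>zeros. \<exists>d\<in>zeros. (s, c) \<in> z \<and> (c, d) \<in> ?J \<and> (d, t) \<in> z"
          then obtain c d where c: "c \<in> zeros" "(s, c) \<in> z" "(c, d) \<in> ?J" "(d, t) \<in> z"
            by blast
          have "(c, r) \<in> ?J"
            using c(3,4) tr by (meson UnI1 UnI2 rtrancl.rtrancl_into_rtrancl)
          then show ?thesis
            using c 2 Z.refl by blast
        qed
      qed
    qed
  qed
  show ?thesis
  proof clarify
    fix s t assume st: "(s, t) \<in> ?J" "(s, t) \<in> y"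
    from split[OF st(1)] show "(s, t) \<in> ?R"
    proof
      assume "\<exists>c\<in>zeros. \<exists>d\<in>zeros. (s, c) \<in> z \<and> (c, d) \<in> ?J \<and> (d, t) \<in> z"
      then obtain c d where cd: "c \<in> zeros" "d \<in> zeros" "(s, c) \<in> z" "(c, d) \<in> ?J" "(d, t) \<in> z"
        by blast
      have "(c, s) \<in> y" "(t, d) \<in> y"
        using cd zy Z.sym by blast+
      then have "(c, d) \<in> y"
        using st(2) Y.trans by blast
      then have "(c, d) \<in> ?R"
        using cd by (intro zeros)
      then show ?thesis
        using cd R.trans by (meson UnI2 r_into_rtrancl)
    qed blast
  qed
qed

theorem corollary7p3:
  fixes X :: "'a::infinite alg21 set"
  assumes "epigroup_variety X"
    and "lower_modular_element EPI X"
  shows "modular_element EPI X"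
proof -
  obtain k where k: "epi_axioms k \<subseteq> Eq X" and X: "eq_theory (Eq X)"
    using epi_theory_Eq[OF assms(1)] unfolding epi_theory_def by blast
  interpret lower_modular_variety X "Suc k"
    using assms eq_theory.epi_axioms_Suc[OF X k] by unfold_locales auto
  show ?thesis
    using assms(1) modular_inclusion by (rule modular_elementI)
qed

end
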